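(* Let $2\le n<\infty$, let $\mathcal O_n$ be the Cuntz algebra with canonical generating isometries $\mathfrak s_1,\dots,\mathfrak s_n$ (so $\sum_i\mathfrak s_i\mathfrak s_i^*=1$), and let $\mathfrak A_n$ be the non-commutative disk algebra, the norm-closed unital (non-self-adjoint) subalgebra of $\mathcal O_n$ generated by $\mathfrak s_1,\dots,\mathfrak s_n$. If $\alpha$ is a unital $*$-endomorphism of $\mathcal O_n$ with $\alpha(\mathfrak A_n)\subseteq\mathfrak A_n$, then $\alpha$ is a $*$-automorphism of $\mathcal O_n$ with $\alpha(\mathfrak A_n)=\mathfrak A_n$. *)

theory Defs
  imports "HOL-Analysis.Analysis"
begin

text \<open>A unital C*-algebra, presented as a unital real Banach algebra (type class
  real_normed_algebra_1 + banach, so norm 1 = 1 and the norm is submultiplicative)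
  together with a complex scalar multiplication cs extending scaleR and an
  involution adj satisfying the C*-identity.\<close>

definition cstar_algebra ::
  "(complex \<Rightarrow> 'a::{real_normed_algebra_1,banach} \<Rightarrow> 'a) \<Rightarrow> ('a \<Rightarrow> 'a) \<Rightarrow> bool" where
  "cstar_algebra cs adj \<longleftrightarrow>
     (\<forall>c d x. cs (c + d) x = cs c x + cs d x) \<and>
     (\<forall>c x y. cs c (x + y) = cs c x + cs c y) \<and>
     (\<forall>c d x. cs (c * d) x = cs c (cs d x)) \<and>
     (\<forall>r x. cs (complex_of_real r) x = scaleR r x) \<and>
     (\<forall>c x y. cs c (x * y) = cs c x * y) \<and>
     (\<forall>c x y. cs c (x * y) = x * cs c y) \<and>
     (\<forall>c x. norm (cs c x) = cmod c * norm x) \<and>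
     (\<forall>x. adj (adj x) = x) \<and>
     (\<forall>x y. adj (x + y) = adj x + adj y) \<and>
     (\<forall>c x. adj (cs c x) = cs (cnj c) (adj x)) \<and>
     (\<forall>x y. adj (x * y) = adj y * adj x) \<and>
     (\<forall>x. norm (adj x * x) = (norm x)\<^sup>2)"

definition closed_alg_gen ::
  "(complex \<Rightarrow> 'a::{real_normed_algebra_1,banach} \<Rightarrow> 'a) \<Rightarrow> 'a set \<Rightarrow> 'a set" where
  "closed_alg_gen cs S = \<Inter>{B. S \<subseteq> B \<and> 1 \<in> B \<and> closed B \<and>
       (\<forall>x\<in>B. \<forall>y\<in>B. x + y \<in> B \<and> x * y \<in> B) \<and> (\<forall>c. \<forall>x\<in>B. cs c x \<in> B)}"

definition cstar_gen ::
  "(complex \<Rightarrow> 'a::{real_normed_algebra_1,banach} \<Rightarrow> 'a) \<Rightarrow> ('a \<Rightarrow> 'a) \<Rightarrow> 'a set \<Rightarrow> 'a set" where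
  "cstar_gen cs adj S = \<Inter>{B. S \<subseteq> B \<and> 1 \<in> B \<and> closed B \<and>
       (\<forall>x\<in>B. \<forall>y\<in>B. x + y \<in> B \<and> x * y \<in> B) \<and> (\<forall>c. \<forall>x\<in>B. cs c x \<in> B) \<and>
       (\<forall>x\<in>B. adj x \<in> B)}"

text \<open>s 1, ..., s n are isometries with sum of range projections 1 generating the
  whole C*-algebra; by Cuntz's uniqueness theorem (simplicity of O_n) the algebra is
  then (canonically isomorphic to) the Cuntz algebra O_n with canonical generators.\<close>
definition cuntz_generators ::
  "(complex \<Rightarrow> 'a::{real_normed_algebra_1,banach} \<Rightarrow> 'a) \<Rightarrow> ('a \<Rightarrow> 'a) \<Rightarrow> nat \<Rightarrow> (nat \<Rightarrow> 'a) \<Rightarrow> bool" where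
  "cuntz_generators cs adj n s \<longleftrightarrow>
     (\<forall>i\<in>{1..n}. adj (s i) * s i = 1) \<and>
     (\<Sum>i=1..n. s i * adj (s i)) = 1 \<and>
     cstar_gen cs adj (s ` {1..n}) = UNIV"

definition unital_star_endo ::
  "(complex \<Rightarrow> 'a::{real_normed_algebra_1,banach} \<Rightarrow> 'a) \<Rightarrow> ('a \<Rightarrow> 'a) \<Rightarrow> ('a \<Rightarrow> 'a) \<Rightarrow> bool" where
  "unital_star_endo cs adj \<alpha> \<longleftrightarrow>
     (\<forall>x y. \<alpha> (x + y) = \<alpha> x + \<alpha> y) \<and>
     (\<forall>c x. \<alpha> (cs c x) = cs c (\<alpha> x)) \<and>
     (\<forall>x y. \<alpha> (x * y) = \<alpha> x * \<alpha> y) \<and>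
     (\<forall>x. \<alpha> (adj x) = adj (\<alpha> x)) \<and>
     \<alpha> 1 = 1"

text \<open>*-automorphism: a bijective *-endomorphism (its inverse is then automatically
  a *-homomorphism).\<close>
definition star_auto ::
  "(complex \<Rightarrow> 'a::{real_normed_algebra_1,banach} \<Rightarrow> 'a) \<Rightarrow> ('a \<Rightarrow> 'a) \<Rightarrow> ('a \<Rightarrow> 'a) \<Rightarrow> bool" where
  "star_auto cs adj \<alpha> \<longleftrightarrow> unital_star_endo cs adj \<alpha> \<and> bij \<alpha>"

end

theory Submission
  imports Defs "HOL-Real_Asymp.Real_Asymp"
begin

text \<open>Put \<open>t i = \<alpha> (s i)\<close>.  In the vacuum inner product (the Fock space one) on the disk algebra, the
  right ideal generated by the \<open>t i\<close> is a direct sum of \<open>n\<close> free cyclic modules, and since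
  \<open>\<Sum>i. t i * adj (t i) = 1\<close> holds in the Cuntz algebra its cokernel is small in high degrees.
  Counting dimensions by degree, the cokernel is one-dimensional, so modulo the ideal every \<open>s j\<close>
  is a scalar \<open>\<lambda>\<close>.  Explicitly \<open>(1 - \<theta>) (s j - \<lambda>) = y\<close>, where \<open>\<theta>\<close> and \<open>y\<close> are linear
  combinations of the \<open>t i\<close> and \<open>norm \<theta> < 1\<close>; inverting \<open>1 - \<theta>\<close> puts \<open>s j\<close> into the image of \<open>\<alpha>\<close>.\<close>

section \<open>Elementary facts on C*-algebras\<close>

text \<open>The dimension count belongs to Fock space, but the creation operators there violate the
  Cuntz relation: their ranges miss the vacuum. Both sides are needed at once, the Fock product for
  orthogonality and \<open>\<Sum>i. s i * adj (s i) = 1\<close> for smallness in high degrees. The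
  way out is a scalar limit of compressions by long words inside the algebra itself; on products
  \<open>adj a * b\<close> with \<open>a\<close>, \<open>b\<close> in the disk algebra it takes the
  Fock values.

  The algebra is abstract, with the C*-identity as the starting point, so three facts come from norm
  estimates: orthogonality of the ranges of the \<open>s i\<close> (the unit is an extreme point of
  the unit ball), isometry of \<open>\<alpha>\<close>, and faithfulness of the vacuum product (both
  from averaged isometries that almost intertwine). Isometry makes images of closed sets closed, so
  that limits of elements of the image stay in it; faithfulness turns an equality of Fock vectors
  into an equality in the algebra.\<close>

locale cstar =
  fixes cs :: "complex \<Rightarrow> 'a::{real_normed_algebra_1,banach} \<Rightarrow> 'a"
    and adj :: "'a \<Rightarrow> 'a"
  assumes cstar_algebra: "cstar_algebra cs adj"
begin

lemma cs_add_left: "cs (c + d) x = cs c x + cs d x"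
  and cs_add: "cs c (x + y) = cs c x + cs c y"
  and cs_cs: "cs c (cs d x) = cs (c * d) x"
  and cs_of_real: "cs (complex_of_real r) x = scaleR r x"
  and cs_mult_left [simp]: "cs c x * y = cs c (x * y)"
  and cs_mult_right [simp]: "x * cs c y = cs c (x * y)"
  and norm_cs: "norm (cs c x) = cmod c * norm x"
  and adj_adj [simp]: "adj (adj x) = x"
  and adj_add: "adj (x + y) = adj x + adj y"
  and adj_cs: "adj (cs c x) = cs (cnj c) (adj x)"
  and adj_mult: "adj (x * y) = adj y * adj x"
  and cstar_identity: "norm (adj x * x) = (norm x)\<^sup>2"
  using cstar_algebra unfolding cstar_algebra_def by metis+

lemma cs_1 [simp]: "cs 1 x = x"
  using cs_of_real[of 1 x] by simp

lemma cs_0 [simp]: "cs 0 x = 0"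
  using cs_of_real[of 0 x] by simp

lemma bounded_linear_cs: "bounded_linear (cs c)"
  by (rule bounded_linear_intro[where K = "cmod c"])
     (simp_all add: cs_add norm_cs cs_cs mult.commute flip: cs_of_real)

lemma bounded_linear_cs_left: "bounded_linear (\<lambda>c. cs c x)"
  by (rule bounded_linear_intro[where K = "norm x"])
     (simp_all add: cs_add_left norm_cs cs_cs scaleR_conv_of_real[where 'a=complex] flip: cs_of_real)

lemmas cs_zero [simp] = bounded_linear.linear[OF bounded_linear_cs, THEN linear_0]
lemmas cs_diff = bounded_linear.linear[OF bounded_linear_cs, THEN linear_diff]
lemmas cs_diff_left = bounded_linear.linear[OF bounded_linear_cs_left, THEN linear_diff]
lemmas cs_minus_left = bounded_linear.linear[OF bounded_linear_cs_left, THEN linear_neg]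
lemmas cs_sum_left = bounded_linear.linear[OF bounded_linear_cs_left, THEN linear_sum]
lemmas tendsto_cs = bounded_linear.tendsto[OF bounded_linear_cs]

lemma norm_adj [simp]: "norm (adj x) = norm x"
proof -
  have le: "norm x \<le> norm (adj x)" for x
  proof (cases "x = 0")
    case False
    have "norm x * norm x \<le> norm (adj x) * norm x"
      by (metis cstar_identity norm_mult_ineq power2_eq_square)
    thus ?thesis using False by simp
  qed simp
  from le[of x] le[of "adj x"] show ?thesis by simp
qed

lemma adj_scaleR: "adj (scaleR r x) = scaleR r (adj x)"
  using adj_cs[of "complex_of_real r" x] by (simp add: cs_of_real)

lemma bounded_linear_adj: "bounded_linear adj"
  by (rule bounded_linear_intro[where K = 1]) (simp_all add: adj_add adj_scaleR)

lemmas adj_0 [simp] = bounded_linear.linear[OF bounded_linear_adj, THEN linear_0]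
lemmas adj_diff = bounded_linear.linear[OF bounded_linear_adj, THEN linear_diff]
lemmas adj_minus = bounded_linear.linear[OF bounded_linear_adj, THEN linear_neg]
lemmas adj_sum = bounded_linear.linear[OF bounded_linear_adj, THEN linear_sum]
lemmas tendsto_adj = bounded_linear.tendsto[OF bounded_linear_adj]

lemma adj_1 [simp]: "adj 1 = 1"
  by (metis adj_adj adj_mult mult_1 mult.right_neutral)

lemma norm_isometry: "adj v * v = 1 \<Longrightarrow> norm v = 1"
  using cstar_identity[of v] norm_ge_zero[of v] by (simp add: power2_eq_1_iff)

lemma norm_isometry_mult:
  assumes "adj v * v = 1"
  shows "norm (v * x) = norm x"
proof -
  have "adj (v * x) * (v * x) = adj x * (adj v * v) * x"
    by (simp add: adj_mult mult.assoc)
  hence "(norm (v * x))\<^sup>2 = (norm x)\<^sup>2"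
    using cstar_identity[of "v * x"] cstar_identity[of x] assms by simp
  thus ?thesis by simp
qed

lemma norm_projection_le_1:
  assumes "adj p = p" "p * p = p"
  shows "norm p \<le> 1"
proof -
  have "norm p * norm p = norm p"
    using cstar_identity[of p] assms by (simp add: power2_eq_square)
  hence "norm p = 0 \<or> norm p = 1" by simp
  thus ?thesis by auto
qed

lemma adj_mult_self_eq_0: "adj x * x = 0 \<Longrightarrow> x = 0"
  using cstar_identity[of x] by simp

end

section \<open>Square roots from the binomial series\<close>

lemma gbinomial_half_bound: "\<bar>(1/2 :: real) gchoose k\<bar> \<le> 1"
proof (induction k)
  case (Suc k)
  have "(1/2 :: real) gchoose Suc k = ((1/2) gchoose k) * ((1/2 - real k) / real (Suc k))"
    using gbinomial_mult_1[of "1/2 :: real" k] by (simp add: field_simps del: of_nat_Suc)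
  hence "\<bar>(1/2 :: real) gchoose Suc k\<bar> = \<bar>(1/2) gchoose k\<bar> * (\<bar>1/2 - real k\<bar> / real (Suc k))"
    by (simp add: abs_mult)
  also have "\<dots> \<le> 1 * 1"
    by (rule mult_mono) (use Suc in \<open>auto simp: field_simps\<close>)
  finally show ?case by simp
qed simp

text \<open>The coefficients are bounded by 1, so a geometric series dominates; Vandermonde turns
  the Cauchy square into the binomial series with exponent 1, which stops after the linear term. The
  series is handed out along with \<open>y\<close>, so that self-adjointness and commutation can be
  read off term by term.\<close>

lemma sqrt_one_plus_small:
  fixes z :: "'a::{real_normed_algebra_1,banach}"
  assumes "norm z < 1"
  obtains y where "(\<lambda>k. ((1/2) gchoose k) *\<^sub>R z ^ k) sums y" "y * y = 1 + z"
proof -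
  define f where "f k = ((1/2) gchoose k) *\<^sub>R z ^ k" for k
  have "summable (\<lambda>k. norm z ^ k)" using assms by simp
  moreover have "norm (norm (f k)) \<le> norm z ^ k" for k
    using mult_mono[OF gbinomial_half_bound norm_power_ineq[of z k]] by (simp add: f_def)
  ultimately have sn: "summable (\<lambda>k. norm (f k))"
    by (rule summable_comparison_test'[where N = 0])
  have conv: "(\<Sum>i\<le>k. f i * f (k - i)) = (1 gchoose k) *\<^sub>R z ^ k" for k
  proof -
    have "(\<Sum>i\<le>k. f i * f (k - i)) = (\<Sum>i\<le>k. ((1/2 gchoose i) * (1/2 gchoose (k - i))) *\<^sub>R z ^ k)"
      by (rule sum.cong) (simp_all add: f_def flip: power_add)
    also have "\<dots> = (\<Sum>i\<le>k. (1/2 gchoose i) * (1/2 gchoose (k - i))) *\<^sub>R z ^ k"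
      by (simp add: scaleR_sum_left)
    also have "(\<Sum>i\<le>k. (1/2 gchoose i) * (1/2 gchoose (k - i))) = (1 :: real) gchoose k"
      using gbinomial_Vandermonde[of "1/2::real" "1/2" k] by (simp add: atLeast0AtMost)
    finally show ?thesis .
  qed
  have "(\<lambda>k. (1 gchoose k) *\<^sub>R z ^ k) sums (suminf f * suminf f)"
    using Cauchy_product_sums[OF sn sn] by (simp add: conv)
  moreover have "(\<lambda>k. (1 gchoose k) *\<^sub>R z ^ k) sums (\<Sum>k\<in>{0,1}. ((1::real) gchoose k) *\<^sub>R z ^ k)"
  proof (rule sums_finite)
    fix k :: nat assume "k \<notin> {0,1}"
    hence "(1::nat) choose k = 0" by (intro binomial_eq_0) auto
    hence "(1::real) gchoose k = 0" by (metis binomial_gbinomial of_nat_0 of_nat_1)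
    thus "((1::real) gchoose k) *\<^sub>R z ^ k = 0" by simp
  qed simp
  ultimately have "suminf f * suminf f = 1 + z"
    using sums_unique2 by fastforce
  moreover have "f sums suminf f" using sn summable_norm_cancel summable_sums by blast
  ultimately show ?thesis using that unfolding f_def by blast
qed

context cstar
begin

text \<open>If \<open>norm h < 1\<close> and \<open>y\<close> is the square root of \<open>1 - h\<^sup>2\<close>, then \<open>\<alpha> h \<plusminus> \<i> \<alpha> y\<close> are unitary with
  mean \<open>\<alpha> h\<close>; no spectral theory is needed.\<close>

lemma star_endo_norm_le:
  assumes "unital_star_endo cs adj \<alpha>"
  shows "norm (\<alpha> x) \<le> norm x"
proof -
  have add: "\<alpha> (x + y) = \<alpha> x + \<alpha> y" and acs: "\<alpha> (cs c x) = cs c (\<alpha> x)"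
    and mult: "\<alpha> (x * y) = \<alpha> x * \<alpha> y" and star: "\<alpha> (adj x) = adj (\<alpha> x)"
    and one: "\<alpha> 1 = 1" for x y c
    using assms unfolding unital_star_endo_def by auto
  have small: "norm (\<alpha> h) \<le> 1" if h: "adj h = h" "norm h < 1" for h
  proof -
    have "norm (- (h * h)) < 1"
    proof -
      have "norm (- (h * h)) = norm h ^ 2" using cstar_identity[of h] h by simp
      also have "\<dots> < 1" using h by (simp add: power_less_one_iff)
      finally show ?thesis .
    qed
    then obtain y where y: "(\<lambda>k. ((1/2) gchoose k) *\<^sub>R (- (h * h)) ^ k) sums y" "y * y = 1 - h * h"
      using sqrt_one_plus_small[of "- (h * h)"] by auto
    have ap: "adj (z ^ k) = adj z ^ k" for z :: 'a and k
      by (induction k) (simp_all add: adj_mult power_commutes)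
    have "adj y = y"
      using bounded_linear.sums[OF bounded_linear_adj y(1)] y(1)
      by (auto simp: adj_scaleR ap adj_minus adj_mult h intro: sums_unique2)
    have ch: "h * (- (h * h)) ^ k = (- (h * h)) ^ k * h" for k
      by (induction k) (simp_all add: mult.assoc flip: power_Suc2, metis mult.assoc)
    have "(\<lambda>k. h * (((1/2) gchoose k) *\<^sub>R (- (h * h)) ^ k)) sums (h * y)"
      by (rule sums_mult[OF y(1)])
    moreover have "(\<lambda>k. (((1/2) gchoose k) *\<^sub>R (- (h * h)) ^ k) * h) sums (y * h)"
      by (rule sums_mult2[OF y(1)])
    ultimately have comm: "h * y = y * h"
      by (auto simp: ch intro: sums_unique2)
    define a b where "a = \<alpha> h" and "b = \<alpha> y"
    have ab: "adj a = a" "adj b = b" "a * b = b * a" "a * a + b * b = 1"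
      unfolding a_def b_def using h \<open>adj y = y\<close> comm y(2)
      by (simp_all flip: star mult add add: one)
    have "adj (a + cs c b) * (a + cs c b) = 1" if "c = \<i> \<or> c = - \<i>" for c
      using that ab by (auto simp: adj_add adj_cs ring_distribs cs_cs cs_minus_left cs_add cs_diff)
    hence "norm (a + cs \<i> b) = 1" "norm (a + cs (-\<i>) b) = 1"
      using norm_isometry by blast+
    moreover have "2 *\<^sub>R a = (a + cs \<i> b) + (a + cs (-\<i>) b)"
      by (simp add: cs_minus_left scaleR_2)
    ultimately have "norm (2 *\<^sub>R a) \<le> 2"
      by (metis norm_triangle_ineq one_add_one)
    thus ?thesis by (simp add: a_def)
  qed
  have sa: "norm (\<alpha> h) \<le> norm h" if h: "adj h = h" for h
  proof (rule field_le_epsilon)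
    fix e :: real assume "e > 0"
    define r where "r = norm h + e"
    have r: "r > 0" using \<open>e > 0\<close> by (simp add: r_def add_nonneg_pos)
    have "norm (\<alpha> ((1 / r) *\<^sub>R h)) \<le> 1"
      using r \<open>e > 0\<close> by (intro small) (auto simp: adj_scaleR h r_def)
    also have "\<alpha> ((1 / r) *\<^sub>R h) = (1 / r) *\<^sub>R \<alpha> h" by (simp only: acs flip: cs_of_real)
    finally show "norm (\<alpha> h) \<le> norm h + e" using r by (simp add: r_def field_simps)
  qed
  have "(norm (\<alpha> x))\<^sup>2 = norm (\<alpha> (adj x * x))"
    by (simp add: cstar_identity mult star)
  also have "\<dots> \<le> norm (adj x * x)" by (rule sa) (simp add: adj_mult)
  finally have "(norm (\<alpha> x))\<^sup>2 \<le> (norm x)\<^sup>2" by (simp add: cstar_identity)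
  thus ?thesis by (rule power2_le_imp_le) simp
qed

text \<open>The unit is an extreme point of the unit ball.  The averaging step below improves
  a bound for \<open>1 + z g\<close> on the unit disc by the factor 4/3 each time.\<close>

lemma extreme_unit:
  assumes g: "adj g = g" and p: "norm (1 + g) \<le> 1" and m: "norm (1 - g) \<le> 1"
  shows "g = 0"
proof -
  \<comment> \<open>From real to imaginary directions: \<open>1 + g * g\<close> is the mean of the
    squares of \<open>1 + g\<close> and \<open>1 - g\<close>, and it is also
    \<open>adj u * u\<close> for \<open>u = 1 + cs c g\<close> with \<open>c\<close> equal to \<i>
    or -\<i>.\<close>
  have "norm (2 *\<^sub>R (1 + g * g)) \<le> 2"
  proof -
    have "2 *\<^sub>R (1 + g * g) = (1 + g) * (1 + g) + (1 - g) * (1 - g)"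
      by (simp add: algebra_simps scaleR_2)
    also have "norm \<dots> \<le> norm (1 + g) * norm (1 + g) + norm (1 - g) * norm (1 - g)"
      by (meson add_mono norm_mult_ineq norm_triangle_ineq order_trans)
    also have "\<dots> \<le> 1 * 1 + 1 * 1" by (intro add_mono mult_mono p m) auto
    finally show ?thesis by simp
  qed
  hence gg: "norm (1 + g * g) \<le> 1" by simp
  have i: "norm (1 + cs c g) \<le> 1" if "c = \<i> \<or> c = -\<i>" for c
  proof -
    have "adj (1 + cs c g) * (1 + cs c g) = 1 + g * g"
      using that g by (auto simp: adj_add adj_cs ring_distribs cs_cs cs_minus_left cs_add cs_diff)
    hence "(norm (1 + cs c g))\<^sup>2 \<le> 1\<^sup>2" using cstar_identity[of "1 + cs c g"] gg by simp
    thus ?thesis by (rule power2_le_imp_le) simp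
  qed
  define Q where "Q g \<longleftrightarrow> (\<forall>z. cmod z \<le> 1 \<longrightarrow> norm (1 + cs z g) \<le> 1)" for g
  have step: "Q ((4/3) *\<^sub>R g)" if "Q g" for g
    unfolding Q_def
  proof (intro allI impI)
    fix z assume z: "cmod z \<le> 1"
    \<comment> \<open>A primitive sixth root of unity. The numbers 1, \<open>d\<close>,
      \<open>cnj d\<close> have sum 2, while their squares have sum 0; so the mean of the three
      squares \<open>(1 + c z g)^2\<close> over these \<open>c\<close> loses its
      \<open>g * g\<close> term and equals \<open>1 + (4/3) z g\<close>.\<close>
    define d where "d = Complex (1/2) (sqrt 3 / 2)"
    have d: "d + cnj d = 1" "d * d + cnj d * cnj d = - 1" "cmod d = 1"
      by (simp_all add: d_def complex_eq_iff cmod_def power2_eq_square)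
    have sq: "norm ((1 + cs (z * e) g) * (1 + cs (z * e) g)) \<le> 1" if "cmod e = 1" for e
    proof -
      have "norm (1 + cs (z * e) g) \<le> 1"
        using \<open>Q g\<close> z that by (simp add: Q_def norm_mult)
      thus ?thesis by (meson mult_le_one norm_ge_zero norm_mult_ineq order_trans)
    qed
    have ex: "(1 + cs c g) * (1 + cs c g) = 1 + cs (2 * c) g + cs (c * c) (g * g)" for c
      by (simp only: ring_distribs cs_add cs_add_left mult_2 cs_mult_left cs_mult_right cs_cs) simp
    have "3 *\<^sub>R (1 + cs z ((4/3) *\<^sub>R g)) = 3 *\<^sub>R 1 + cs (4 * z) g"
      by (simp add: cs_add cs_cs mult.commute flip: cs_of_real)
    also have "\<dots> = (1 + cs (z * 1) g) * (1 + cs (z * 1) g)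
        + (1 + cs (z * d) g) * (1 + cs (z * d) g) + (1 + cs (z * cnj d) g) * (1 + cs (z * cnj d) g)"
    proof -
      have "2 * (z * 1) + 2 * (z * d) + 2 * (z * cnj d) = 2 * z * (1 + (d + cnj d))"
        by (simp only: algebra_simps mult_1_right)
      also have "\<dots> = 4 * z" by (simp add: d)
      finally have 1: "cs (4 * z) g = cs (2 * (z * 1)) g + cs (2 * (z * d)) g + cs (2 * (z * cnj d)) g"
        by (simp only: cs_add_left[symmetric])
      have "z * 1 * (z * 1) + z * d * (z * d) + z * cnj d * (z * cnj d)
          = z * z * (1 + (d * d + cnj d * cnj d))"
        by (simp add: algebra_simps)
      also have "\<dots> = 0" by (simp add: d)
      finally have 2: "cs (z * 1 * (z * 1)) (g * g) + cs (z * d * (z * d)) (g * g)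
          + cs (z * cnj d * (z * cnj d)) (g * g) = 0"
        by (simp only: cs_add_left[symmetric] cs_0)
      have 3: "3 *\<^sub>R 1 = (1 + 1 + 1 :: 'a)"
        by (simp add: scaleR_conv_of_real)
      show ?thesis
        unfolding ex 3 using 1 2 by (simp add: algebra_simps)
    qed
    also have "norm \<dots> \<le> 1 + 1 + 1"
      by (intro norm_triangle_le add_mono order_trans[OF norm_triangle_ineq] sq) (auto simp: d)
    finally show "norm (1 + cs z ((4/3) *\<^sub>R g)) \<le> 1" by simp
  qed
  \<comment> \<open>The directions 1, -1, \<i>, -\<i> are settled. Their convex hull contains the
    disc of radius 1/2, whence the factor.\<close>
  have base: "Q ((1/2) *\<^sub>R g)"
    unfolding Q_def
  proof (intro allI impI)
    fix z assume z: "cmod z \<le> 1"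
    define x y where "x = Re z / 2" and "y = Im z / 2"
    have xy: "\<bar>x\<bar> \<le> 1/2" "\<bar>y\<bar> \<le> 1/2"
      using z abs_Re_le_cmod[of z] abs_Im_le_cmod[of z] by (auto simp: x_def y_def)
    have X: "norm (\<bar>x\<bar> *\<^sub>R 1 + x *\<^sub>R g) \<le> \<bar>x\<bar>"
    proof -
      have "\<bar>x\<bar> *\<^sub>R 1 + x *\<^sub>R g = \<bar>x\<bar> *\<^sub>R (1 + sgn x *\<^sub>R g)"
        by (simp add: scaleR_add_right abs_mult_sgn)
      moreover have "norm (1 + sgn x *\<^sub>R g) \<le> 1" using p m by (auto simp: sgn_if)
      ultimately show ?thesis by (simp add: mult_left_le)
    qed
    have Y: "norm (\<bar>y\<bar> *\<^sub>R 1 + cs (\<i> * y) g) \<le> \<bar>y\<bar>"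
    proof -
      have "\<bar>y\<bar> *\<^sub>R 1 + cs (\<i> * y) g = \<bar>y\<bar> *\<^sub>R (1 + cs (\<i> * of_real (sgn y)) g)"
        by (simp add: cs_add cs_cs mult.left_commute abs_mult_sgn flip: cs_of_real of_real_mult)
      moreover have "norm (1 + cs (\<i> * of_real (sgn y)) g) \<le> 1" using i by (auto simp: sgn_if)
      ultimately show ?thesis by (simp add: mult_left_le)
    qed
    have "1 + cs z ((1/2) *\<^sub>R g)
        = (\<bar>x\<bar> *\<^sub>R 1 + x *\<^sub>R g) + (\<bar>y\<bar> *\<^sub>R 1 + cs (\<i> * y) g) + (1 - \<bar>x\<bar> - \<bar>y\<bar>) *\<^sub>R 1"
    proof -
      have "cs z ((1/2) *\<^sub>R g) = cs (of_real x + \<i> * y) g"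
        by (simp add: cs_cs x_def y_def flip: cs_of_real)
           (metis (no_types, lifting) add_divide_distrib complex_eq times_divide_eq_right)
      thus ?thesis by (simp add: cs_add_left cs_of_real scaleR_diff_left)
    qed
    also have "norm \<dots> \<le> \<bar>x\<bar> + \<bar>y\<bar> + (1 - \<bar>x\<bar> - \<bar>y\<bar>)"
      by (intro norm_triangle_le add_mono X Y order_trans[OF norm_triangle_ineq]) (use xy in auto)
    finally show "norm (1 + cs z ((1/2) *\<^sub>R g)) \<le> 1" by simp
  qed
  have "Q (((4/3) ^ k * (1/2)) *\<^sub>R g)" for k
  proof (induction k)
    case (Suc k)
    from step[OF Suc] show ?case by (simp add: mult.assoc)
  qed (use base in simp)
  hence "norm (1 + ((4/3) ^ k * (1/2)) *\<^sub>R g) \<le> 1" for k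
    unfolding Q_def by (metis cs_1 norm_one order_refl)
  hence "norm (((4/3) ^ k * (1/2)) *\<^sub>R g) \<le> 2" for k
    using norm_triangle_ineq4[of "1 + ((4/3) ^ k * (1/2)) *\<^sub>R g" 1] by (smt (verit) add_diff_cancel_left' norm_one)
  hence bd: "(4/3) ^ k * norm g \<le> 4" for k :: nat by (simp add: field_simps)
  show ?thesis
  proof (rule ccontr)
    assume "g \<noteq> 0"
    obtain k :: nat where "4 / norm g < (4/3) ^ k"
      using real_arch_pow[of "4/3"] by auto
    with bd[of k] \<open>g \<noteq> 0\<close> show False by (simp add: field_simps)
  qed
qed

end

section \<open>Cuntz families\<close>

locale cuntz = cstar cs adj
  for cs :: "complex \<Rightarrow> 'a::{real_normed_algebra_1,banach} \<Rightarrow> 'a" and adj +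
  fixes n :: nat and s :: "nat \<Rightarrow> 'a"
  assumes n_ge_2: "2 \<le> n"
    and cuntz_generators: "cuntz_generators cs adj n s"
begin

lemma isometry: "i \<in> {1..n} \<Longrightarrow> adj (s i) * s i = 1"
  and sum_range_projections: "(\<Sum>i=1..n. s i * adj (s i)) = 1"
  using cuntz_generators unfolding cuntz_generators_def by auto

lemma cstar_gen_eq_UNIV:
  assumes "\<And>i. i \<in> {1..n} \<Longrightarrow> s i \<in> B" "1 \<in> B" "closed B"
    "\<And>x y. x \<in> B \<Longrightarrow> y \<in> B \<Longrightarrow> x + y \<in> B" "\<And>x y. x \<in> B \<Longrightarrow> y \<in> B \<Longrightarrow> x * y \<in> B"
    "\<And>c x. x \<in> B \<Longrightarrow> cs c x \<in> B" "\<And>x. x \<in> B \<Longrightarrow> adj x \<in> B"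
  shows "B = UNIV"
proof -
  have "cstar_gen cs adj (s ` {1..n}) \<subseteq> B"
    unfolding cstar_gen_def using assms by (intro Inter_lower) auto
  thus ?thesis using cuntz_generators unfolding cuntz_generators_def by auto
qed

text \<open>The compressions \<open>h k\<close> of the range projections to the range of
  \<open>s j\<close> sum to 1 and \<open>h j = 1\<close>, so with positivity the others would
  vanish. As a substitute, every \<open>1 - h k\<close> lies in the unit ball and \<open>h i\<close>
  is minus the sum of the \<open>h k\<close> over \<open>R\<close>. With \<open>g = h i / n\<close>,
  both \<open>1 - g\<close> and \<open>1 + g\<close> are then means of \<open>n\<close> elements of
  the unit ball, and extremality of the unit gives \<open>g = 0\<close>.\<close>

lemma orthogonal:
  assumes ij: "i \<in> {1..n}" "j \<in> {1..n}" "i \<noteq> j"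
  shows "adj (s i) * s j = 0"
proof -
  define p where "p k = s k * adj (s k)" for k
  define h where "h k = adj (s j) * p k * s j" for k
  have p: "adj (p k) = p k" "p k * p k = p k" if "k \<in> {1..n}" for k
  proof -
    have "p k * p k = s k * (adj (s k) * s k) * adj (s k)" by (simp add: p_def mult.assoc)
    thus "p k * p k = p k" using isometry[OF that] by (simp add: p_def)
  qed (simp add: p_def adj_mult)
  have h1: "norm (1 - h k) \<le> 1" if k: "k \<in> {1..n}" for k
  proof -
    have "1 - h k = adj (s j) * (1 - p k) * s j"
      using isometry[OF ij(2)] by (simp add: h_def algebra_simps)
    also have "norm \<dots> \<le> norm (adj (s j)) * norm (1 - p k) * norm (s j)"
      by (rule order_trans[OF norm_mult_ineq mult_right_mono[OF norm_mult_ineq norm_ge_zero]])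
    also have "\<dots> \<le> 1"
    proof -
      have "norm (1 - p k) \<le> 1"
        by (rule norm_projection_le_1) (simp_all add: p[OF k] adj_diff algebra_simps)
      thus ?thesis using norm_isometry[OF isometry[OF ij(2)]] by simp
    qed
    finally show ?thesis .
  qed
  define R where "R = {1..n} - {i, j}"
  have R: "{1..n} = insert i (insert j R)" "i \<notin> insert j R" "j \<notin> R" "finite R"
    using ij by (auto simp: R_def)
  have card: "card R = n - 2"
    using ij by (simp add: R_def card_Diff_subset)
  have "(\<Sum>k=1..n. h k) = adj (s j) * (\<Sum>k=1..n. p k) * s j"
    by (simp add: h_def sum_distrib_left sum_distrib_right)
  also have "\<dots> = 1" using sum_range_projections isometry[OF ij(2)] by (simp add: p_def)
  finally have "h i + (h j + sum h R) = 1" using R by simp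
  moreover have "h j = 1"
  proof -
    have "h j = (adj (s j) * s j) * (adj (s j) * s j)" by (simp add: h_def p_def mult.assoc)
    thus ?thesis using isometry[OF ij(2)] by simp
  qed
  ultimately have hi: "h i = - sum h R" by (simp add: eq_neg_iff_add_eq_0)
  define g where "g = (1 / real n) *\<^sub>R h i"
  have n0: "real n > 0" using n_ge_2 by simp
  have "1 - g = (1 / real n) *\<^sub>R ((real n - 1) *\<^sub>R 1 + (1 - h i))"
    using n0 by (simp add: g_def algebra_simps flip: scaleR_add_left)
  moreover have "norm ((real n - 1) *\<^sub>R 1 + (1 - h i)) \<le> (real n - 1) + 1"
    using n_ge_2 by (intro norm_triangle_le add_mono h1 ij) auto
  ultimately have "norm (1 - g) \<le> \<bar>1 / real n\<bar> * ((real n - 1) + 1)"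
    by (metis abs_ge_zero mult_left_mono norm_scaleR)
  hence g1: "norm (1 - g) \<le> 1" using n0 by simp
  have "1 + g = (1 / real n) *\<^sub>R (2 *\<^sub>R 1 + (\<Sum>k\<in>R. 1 - h k))"
  proof -
    have "2 *\<^sub>R 1 + (\<Sum>k\<in>R. 1 - h k) = real n *\<^sub>R 1 + h i"
      using n_ge_2 by (simp add: sum_subtractf hi card scaleR_conv_of_real of_nat_diff)
    thus ?thesis using n0 by (simp add: g_def scaleR_add_right)
  qed
  moreover have "norm (2 *\<^sub>R 1 + (\<Sum>k\<in>R. 1 - h k)) \<le> 2 + real (card R) * 1"
    by (intro norm_triangle_le add_mono sum_norm_bound h1) (auto simp: R_def)
  ultimately have "norm (1 + g) \<le> \<bar>1 / real n\<bar> * (2 + real (card R) * 1)"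
    by (metis abs_ge_zero mult_left_mono norm_scaleR)
  hence g2: "norm (1 + g) \<le> 1" using n0 n_ge_2 card by simp
  have "adj g = g" using p[OF ij(1)] by (simp add: g_def h_def adj_scaleR adj_mult mult.assoc)
  from extreme_unit[OF this g2 g1] n0 have "h i = 0" by (simp add: g_def)
  moreover have "h i = adj (adj (s i) * s j) * (adj (s i) * s j)"
    by (simp add: h_def p_def adj_mult mult.assoc)
  ultimately show ?thesis using adj_mult_self_eq_0 by metis
qed

section \<open>Words in the generators\<close>

definition W :: "nat list \<Rightarrow> 'a" where
  "W \<mu> = prod_list (map s \<mu>)"

definition wds :: "nat \<Rightarrow> nat list set" where
  "wds m = {\<mu>. set \<mu> \<subseteq> {1..n} \<and> length \<mu> = m}"

lemma W_Nil [simp]: "W [] = 1"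
  and W_Cons: "W (i # \<mu>) = s i * W \<mu>"
  and W_append: "W (\<mu> @ \<nu>) = W \<mu> * W \<nu>"
  by (simp_all add: W_def)

lemma finite_wds [simp]: "finite (wds m)"
  unfolding wds_def by (rule finite_lists_length_eq) simp

lemma card_wds: "card (wds m) = n ^ m"
  unfolding wds_def by (simp add: card_lists_length_eq)

lemma wds_0 [simp]: "wds 0 = {[]}"
  by (auto simp: wds_def)

lemma sum_wds_Suc: "(\<Sum>\<mu>\<in>wds (Suc m). f \<mu>) = (\<Sum>i=1..n. \<Sum>\<mu>\<in>wds m. f (i # \<mu>))"
proof -
  have "wds (Suc m) = (\<lambda>(i, \<mu>). i # \<mu>) ` ({1..n} \<times> wds m)"
    by (auto simp: wds_def image_iff length_Suc_conv)
  moreover have "inj_on (\<lambda>(i, \<mu>). i # \<mu>) ({1..n} \<times> wds m)"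
    by (auto simp: inj_on_def)
  ultimately show ?thesis
    by (simp add: sum.reindex sum.cartesian_product case_prod_unfold)
qed

lemma sum_wds_Suc': "(\<Sum>\<mu>\<in>wds (Suc m). f \<mu>) = (\<Sum>\<mu>\<in>wds m. \<Sum>i=1..n. f (\<mu> @ [i]))"
proof -
  have "wds (Suc m) = (\<lambda>(\<mu>, i). \<mu> @ [i]) ` (wds m \<times> {1..n})"
    by (auto simp: wds_def image_iff length_Suc_conv_rev)
  moreover have "inj_on (\<lambda>(\<mu>, i). \<mu> @ [i]) (wds m \<times> {1..n})"
    by (auto simp: inj_on_def)
  ultimately show ?thesis
    by (simp add: sum.reindex sum.cartesian_product case_prod_unfold)
qed

lemma adj_s_mult_s: "i \<in> {1..n} \<Longrightarrow> j \<in> {1..n} \<Longrightarrow> adj (s i) * s j = (if i = j then 1 else 0)"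
  using isometry orthogonal by auto

lemma adj_W_mult_W:
  assumes "set \<mu> \<subseteq> {1..n}" "set \<nu> \<subseteq> {1..n}" "length \<mu> \<le> length \<nu>"
  shows "adj (W \<mu>) * W \<nu> = (if take (length \<mu>) \<nu> = \<mu> then W (drop (length \<mu>) \<nu>) else 0)"
  using assms
proof (induction \<mu> arbitrary: \<nu>)
  case (Cons i \<mu>)
  then obtain j \<nu>' where \<nu>: "\<nu> = j # \<nu>'" by (cases \<nu>) auto
  have "adj (W (i # \<mu>)) * W \<nu> = adj (W \<mu>) * (adj (s i) * s j) * W \<nu>'"
    by (simp add: \<nu> W_Cons adj_mult mult.assoc)
  also have "\<dots> = (if i = j then adj (W \<mu>) * W \<nu>' else 0)"
    using adj_s_mult_s[of i j] Cons.prems \<nu> by simp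
  finally show ?case using Cons \<nu> by auto
qed simp

lemma norm_W: "set \<mu> \<subseteq> {1..n} \<Longrightarrow> norm (W \<mu>) = 1"
  using adj_W_mult_W[of \<mu> \<mu>] norm_isometry by simp

lemma sum_W_adj_W: "(\<Sum>\<mu>\<in>wds m. W \<mu> * adj (W \<mu>)) = 1"
proof (induction m)
  case (Suc m)
  have "(\<Sum>\<mu>\<in>wds (Suc m). W \<mu> * adj (W \<mu>))
      = (\<Sum>i=1..n. s i * (\<Sum>\<mu>\<in>wds m. W \<mu> * adj (W \<mu>)) * adj (s i))"
    by (simp add: sum_wds_Suc W_Cons adj_mult mult.assoc sum_distrib_left sum_distrib_right)
  thus ?case using Suc sum_range_projections by simp
qed simp

text \<open>On words of length at most \<open>L\<close>, the vectors \<open>W \<mu> * aperiodic L\<close> behave like an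
  orthonormal basis: compression by \<open>aperiodic L\<close> plays the role of the Fock vacuum state.\<close>

definition aperiodic :: "nat \<Rightarrow> 'a" where
  "aperiodic L = W (replicate L 1 @ [2])"

text \<open>Prefix comparison of the two extended words. If \<open>\<mu>\<close> is shorter than
  \<open>\<nu>\<close>, the final letter 2 of the first sits at index
  \<open>length \<mu> + L\<close>; there the second still shows a 1, because
  \<open>length \<mu> < length \<nu> \<le> L\<close>. Hence neither is a prefix of the
  other.\<close>

lemma aperiodic_orthonormal:
  assumes "set \<mu> \<subseteq> {1..n}" "set \<nu> \<subseteq> {1..n}" "length \<mu> \<le> L" "length \<nu> \<le> L"
  shows "adj (W \<mu> * aperiodic L) * (W \<nu> * aperiodic L) = (if \<mu> = \<nu> then 1 else 0)"
proof -
  have *: "adj (W \<mu> * aperiodic L) * (W \<nu> * aperiodic L) = (if \<mu> = \<nu> then 1 else 0)"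
    if mn: "set \<mu> \<subseteq> {1..n}" "set \<nu> \<subseteq> {1..n}" "length \<nu> \<le> L" "length \<mu> \<le> length \<nu>" for \<mu> \<nu>
  proof -
    define u :: "nat list" where "u = replicate L 1 @ [2]"
    have u: "set u \<subseteq> {1..n}" "length u = Suc L" using n_ge_2 by (auto simp: u_def)
    have 1: "\<mu> = \<nu>" if eq: "take (length (\<mu> @ u)) (\<nu> @ u) = \<mu> @ u"
    proof (rule ccontr)
      assume ne: "\<mu> \<noteq> \<nu>"
      have "length \<mu> \<noteq> length \<nu>" using eq ne by (auto simp: append_eq_append_conv)
      hence lt: "length \<mu> < length \<nu>" using mn by simp
      define k where "k = length \<mu> + L"
      have "(\<nu> @ u) ! k = (\<mu> @ u) ! k"
        using arg_cong[OF eq, of "\<lambda>l. l ! k"] u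
        by (simp add: k_def del: take_append append_take_drop_id)
      moreover have "(\<mu> @ u) ! k = 2" by (simp add: k_def nth_append u_def)
      moreover have "(\<nu> @ u) ! k = 1"
        using lt mn by (auto simp: k_def nth_append u_def)
      ultimately show False by simp
    qed
    have "adj (W \<mu> * aperiodic L) * (W \<nu> * aperiodic L) = adj (W (\<mu> @ u)) * W (\<nu> @ u)"
      by (simp add: W_append aperiodic_def u_def)
    also have "\<dots> = (if \<mu> = \<nu> then 1 else 0)"
      using 1 mn u by (subst adj_W_mult_W) auto
    finally show ?thesis .
  qed
  show ?thesis
  proof (cases "length \<mu> \<le> length \<nu>")
    case False
    hence "adj (adj (W \<nu> * aperiodic L) * (W \<mu> * aperiodic L)) = adj (if \<nu> = \<mu> then 1 else 0)"
      using *[of \<nu> \<mu>] assms by simp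
    thus ?thesis by (auto simp: adj_mult mult.assoc)
  qed (use * assms in auto)
qed

lemma norm_aperiodic: "norm (aperiodic L) = 1"
  using aperiodic_orthonormal[of "[]" "[]" L] norm_isometry by simp

text \<open>The isometries \<open>intertwiner \<alpha> M L\<close> intertwine the identity and \<open>\<alpha>\<close> up to
  \<open>2 / sqrt M\<close> on generators; they give simplicity (in the form: \<open>\<alpha>\<close> is isometric)
  and, for \<open>\<alpha> = id\<close>, replace Fejer summation.\<close>

definition level :: "('a \<Rightarrow> 'a) \<Rightarrow> nat \<Rightarrow> nat \<Rightarrow> 'a" where
  "level \<alpha> L m = (\<Sum>\<mu>\<in>wds m. \<alpha> (W \<mu> * aperiodic L) * adj (W \<mu>))"

definition intertwiner :: "('a \<Rightarrow> 'a) \<Rightarrow> nat \<Rightarrow> nat \<Rightarrow> 'a" where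
  "intertwiner \<alpha> M L = (1 / sqrt (real M)) *\<^sub>R (\<Sum>m<M. level \<alpha> L m)"

section \<open>Approximate intertwiners for an endomorphism\<close>

context
  fixes \<alpha> :: "'a \<Rightarrow> 'a"
  assumes endo: "unital_star_endo cs adj \<alpha>"
begin

lemma endo_add: "\<alpha> (x + y) = \<alpha> x + \<alpha> y"
  and endo_cs: "\<alpha> (cs c x) = cs c (\<alpha> x)"
  and endo_mult: "\<alpha> (x * y) = \<alpha> x * \<alpha> y"
  and endo_adj: "\<alpha> (adj x) = adj (\<alpha> x)"
  and endo_1: "\<alpha> 1 = 1"
  using endo unfolding unital_star_endo_def by auto

lemma endo_0: "\<alpha> 0 = 0"
  using endo_add[of 0 0] by simp

lemma endo_diff: "\<alpha> (x - y) = \<alpha> x - \<alpha> y"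
  using endo_add[of "x - y" y] by simp

text \<open>\<open>\<alpha>\<close> fixes the scalars 0 and 1 produced by orthonormality of the
  aperiodic vectors, so only diagonal terms survive, and
  \<open>\<Sum>\<mu>. W \<mu> * adj (W \<mu>) = 1\<close> over words of one length.\<close>

lemma level_orthonormal:
  assumes "m \<le> L" "k \<le> L"
  shows "adj (level \<alpha> L m) * level \<alpha> L k = (if m = k then 1 else 0)"
proof -
  have "adj (level \<alpha> L m) * level \<alpha> L k
      = (\<Sum>\<mu>\<in>wds m. \<Sum>\<nu>\<in>wds k.
          W \<mu> * \<alpha> (adj (W \<mu> * aperiodic L) * (W \<nu> * aperiodic L)) * adj (W \<nu>))"
    by (simp add: level_def adj_sum adj_mult sum_product endo_mult endo_adj mult.assoc)
  also have "\<dots> = (\<Sum>\<mu>\<in>wds m. \<Sum>\<nu>\<in>wds k. if \<mu> = \<nu> then W \<mu> * adj (W \<nu>) else 0)"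
    by (intro sum.cong refl, subst aperiodic_orthonormal)
       (use assms in \<open>auto simp: wds_def endo_1 endo_0\<close>)
  also have "\<dots> = (if m = k then 1 else 0)"
  proof (cases "m = k")
    case True thus ?thesis using sum_W_adj_W[of k] by (simp add: sum.delta)
  next
    case False
    thus ?thesis by (auto simp: wds_def intro!: sum.neutral)
  qed
  finally show ?thesis .
qed

lemma level_Suc_mult:
  assumes i: "i \<in> {1..n}"
  shows "level \<alpha> L (Suc m) * s i = \<alpha> (s i) * level \<alpha> L m"
proof -
  have "level \<alpha> L (Suc m) * s i
      = (\<Sum>j=1..n. \<Sum>\<mu>\<in>wds m. \<alpha> (s j) * (\<alpha> (W \<mu> * aperiodic L) * adj (W \<mu>)) * (adj (s j) * s i))"
    by (simp add: level_def sum_wds_Suc W_Cons adj_mult sum_distrib_right endo_mult mult.assoc)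
  also have "\<dots> = (\<Sum>j=1..n. if j = i then
      (\<Sum>\<mu>\<in>wds m. \<alpha> (s j) * (\<alpha> (W \<mu> * aperiodic L) * adj (W \<mu>))) else 0)"
    by (intro sum.cong refl) (use i adj_s_mult_s in auto)
  finally show ?thesis using i by (simp add: level_def sum_distrib_left)
qed

lemma intertwiner_isometry:
  assumes "0 < M" "M \<le> L"
  shows "adj (intertwiner \<alpha> M L) * intertwiner \<alpha> M L = 1"
proof -
  have "adj (\<Sum>m<M. level \<alpha> L m) * (\<Sum>m<M. level \<alpha> L m)
      = (\<Sum>m<M. \<Sum>k<M. adj (level \<alpha> L m) * level \<alpha> L k)"
    by (simp add: adj_sum sum_product)
  also have "\<dots> = (\<Sum>m<M. \<Sum>k<M. if m = k then 1 else 0)"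
    by (intro sum.cong refl level_orthonormal) (use assms in auto)
  also have "\<dots> = real M *\<^sub>R 1" by (simp add: scaleR_conv_of_real)
  finally show ?thesis using assms by (simp add: intertwiner_def adj_scaleR)
qed

text \<open>A generator on the right strips the first letter and lowers the level by one, so the two
  sums telescope. Only the bottom and the top level remain, each contributing norm at most 1; the
  rest of the bound is the normalising factor.\<close>

lemma intertwiner_s:
  assumes "0 < M" "M \<le> L" and i: "i \<in> {1..n}"
  shows "norm (intertwiner \<alpha> M L * s i - \<alpha> (s i) * intertwiner \<alpha> M L) \<le> 2 / sqrt (real M)"
proof -
  obtain K where K: "M = Suc K" using assms by (cases M) auto
  have nl: "norm (level \<alpha> L m) = 1" if "m \<le> L" for m
    using level_orthonormal[of m L m] that norm_isometry by simp
  have ns: "norm (s i) = 1" "norm (\<alpha> (s i)) = 1"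
    using isometry[OF i] norm_isometry endo_adj endo_mult endo_1 by metis+
  have "(\<Sum>m<M. level \<alpha> L m) * s i - \<alpha> (s i) * (\<Sum>m<M. level \<alpha> L m)
      = level \<alpha> L 0 * s i + (\<Sum>m<K. level \<alpha> L (Suc m) * s i)
        - ((\<Sum>m<K. \<alpha> (s i) * level \<alpha> L m) + \<alpha> (s i) * level \<alpha> L K)"
    unfolding K sum.lessThan_Suc_shift[of "level \<alpha> L" K, THEN arg_cong[of _ _ "\<lambda>x. x * s i"]]
    by (simp add: ring_distribs sum_distrib_left sum_distrib_right)
  also have "\<dots> = level \<alpha> L 0 * s i - \<alpha> (s i) * level \<alpha> L K"
    by (simp add: level_Suc_mult[OF i])
  finally have *: "intertwiner \<alpha> M L * s i - \<alpha> (s i) * intertwiner \<alpha> M L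
      = (1 / sqrt (real M)) *\<^sub>R (level \<alpha> L 0 * s i - \<alpha> (s i) * level \<alpha> L K)"
    by (simp add: intertwiner_def flip: scaleR_diff_right)
  have "norm (level \<alpha> L 0 * s i - \<alpha> (s i) * level \<alpha> L K)
      \<le> norm (level \<alpha> L 0) * norm (s i) + norm (\<alpha> (s i)) * norm (level \<alpha> L K)"
    by (meson add_mono norm_mult_ineq norm_triangle_ineq4 order_trans)
  also have "\<dots> = 2" using nl[of 0] nl[of K] ns assms K by simp
  finally show ?thesis using assms by (simp add: * divide_right_mono)
qed

text \<open>The defect \<open>D M\<close> obeys a twisted Leibniz rule, so convergence to 0 passes
  to sums and products, and to limits because \<open>\<alpha>\<close> is contractive. Adjoints are
  not covered by this: for \<open>adj (s i)\<close> the defect is rewritten through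
  \<open>\<Sum>j. s j * adj (s j) = 1\<close> in terms of the defects of the \<open>s j\<close>, and
  the set \<open>B\<close> asks for convergence at \<open>x\<close> and at
  \<open>adj x\<close>.\<close>

lemma intertwiner_tendsto:
  assumes L: "\<And>M. Suc M \<le> L M"
  shows "(\<lambda>M. intertwiner \<alpha> (Suc M) (L M) * x - \<alpha> x * intertwiner \<alpha> (Suc M) (L M)) \<longlonglongrightarrow> 0"
proof -
  define V where "V M = intertwiner \<alpha> (Suc M) (L M)" for M
  define D where "D M x = V M * x - \<alpha> x * V M" for M x
  define P where "P x \<longleftrightarrow> (\<lambda>M. D M x) \<longlonglongrightarrow> 0" for x
  have nV: "norm (V M) = 1" for M
    unfolding V_def using L by (intro norm_isometry intertwiner_isometry) auto
  have s1: "P (s i)" if "i \<in> {1..n}" for i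
    unfolding P_def
  proof (rule Lim_null_comparison)
    show "\<forall>\<^sub>F M in sequentially. norm (D M (s i)) \<le> 2 / sqrt (real (Suc M))"
      unfolding D_def V_def by (intro always_eventually allI intertwiner_s L that) simp
    show "(\<lambda>M. 2 / sqrt (real (Suc M))) \<longlonglongrightarrow> 0"
      by (rule LIMSEQ_Suc) real_asymp
  qed
  have s2: "P (adj (s i))" if i: "i \<in> {1..n}" for i
  proof -
    have "D M (adj (s i)) = - (\<Sum>j=1..n. adj (\<alpha> (s i)) * D M (s j) * adj (s j))" for M
    proof -
      have "(\<Sum>j=1..n. adj (\<alpha> (s i)) * D M (s j) * adj (s j))
          = adj (\<alpha> (s i)) * V M * (\<Sum>j=1..n. s j * adj (s j))
            - (\<Sum>j=1..n. \<alpha> (adj (s i) * s j) * V M * adj (s j))"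
        by (simp add: D_def algebra_simps sum_subtractf sum_distrib_left endo_mult endo_adj)
      also have "(\<Sum>j=1..n. \<alpha> (adj (s i) * s j) * V M * adj (s j))
          = (\<Sum>j=1..n. if i = j then V M * adj (s j) else 0)"
        by (intro sum.cong refl) (use i adj_s_mult_s endo_1 endo_0 in auto)
      finally show ?thesis
        using i sum_range_projections by (simp add: D_def endo_adj)
    qed
    moreover have "(\<lambda>M. - (\<Sum>j=1..n. adj (\<alpha> (s i)) * D M (s j) * adj (s j)))
        \<longlonglongrightarrow> - (\<Sum>j=1..n. adj (\<alpha> (s i)) * 0 * adj (s j))"
      by (intro tendsto_intros) (use s1 P_def in auto)
    ultimately show ?thesis by (simp add: P_def)
  qed
  have add: "P (x + y)" if "P x" "P y" for x y
    using tendsto_add[OF that[unfolded P_def]] by (simp add: P_def D_def endo_add algebra_simps)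
  have mult: "P (x * y)" if "P x" "P y" for x y
  proof -
    have "D M (x * y) = D M x * y + \<alpha> x * D M y" for M
      by (simp add: D_def endo_mult algebra_simps)
    moreover have "(\<lambda>M. D M x * y + \<alpha> x * D M y) \<longlonglongrightarrow> 0 * y + \<alpha> x * 0"
      by (intro tendsto_intros that[unfolded P_def])
    ultimately show ?thesis by (simp add: P_def)
  qed
  have sc: "P (cs c x)" if "P x" for c x
    using tendsto_cs[OF that[unfolded P_def], of c] by (simp add: P_def D_def endo_cs cs_diff)
  have cl: "P l" if f: "\<And>k. P (f k)" "f \<longlonglongrightarrow> l" for f l
    unfolding P_def
  proof (rule LIMSEQ_I)
    fix r :: real assume "r > 0"
    then obtain k where k: "norm (f k - l) < r / 4"
      using LIMSEQ_D[OF f(2), of "r / 4"] by auto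
    obtain M0 where M0: "\<And>M. M \<ge> M0 \<Longrightarrow> norm (D M (f k)) < r / 2"
      using LIMSEQ_D[OF f(1)[of k, unfolded P_def], of "r / 2"] \<open>r > 0\<close> by auto
    have "norm (D M l - 0) < r" if "M \<ge> M0" for M
    proof -
      have "D M l = D M (f k) - V M * (f k - l) + \<alpha> (f k - l) * V M"
        by (simp add: D_def endo_diff algebra_simps)
      also have "norm \<dots> \<le> norm (D M (f k)) + norm (V M * (f k - l)) + norm (\<alpha> (f k - l) * V M)"
        by (meson add_mono norm_triangle_ineq norm_triangle_ineq4 order_refl order_trans)
      also have "\<dots> \<le> norm (D M (f k)) + norm (f k - l) + norm (f k - l)"
        using norm_mult_ineq[of "V M" "f k - l"] norm_mult_ineq[of "\<alpha> (f k - l)" "V M"] nV[of M]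
          star_endo_norm_le[OF endo, of "f k - l"] by simp
      also have "\<dots> < r" using M0[OF that] k by simp
      finally show ?thesis by simp
    qed
    thus "\<exists>M0. \<forall>M\<ge>M0. norm (D M l - 0) < r" by blast
  qed
  define B where "B = {x. P x \<and> P (adj x)}"
  have "closed B"
    unfolding closed_sequential_limits B_def using cl tendsto_adj by fast
  moreover have "P 1" by (simp add: P_def D_def endo_1)
  ultimately have "B = UNIV"
    using s1 s2 add mult sc by (intro cstar_gen_eq_UNIV) (auto simp: B_def adj_add adj_mult adj_cs)
  thus ?thesis unfolding B_def P_def D_def V_def by blast
qed

text \<open>\<open>V M * x\<close> has the norm of \<open>x\<close> and is close to
  \<open>\<alpha> x * V M\<close>, so \<open>\<alpha>\<close> cannot shrink norms; it cannot enlarge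
  them by contractivity.\<close>

lemma endo_isometric: "norm (\<alpha> x) = norm x"
proof (rule antisym)
  define V where "V M = intertwiner \<alpha> (Suc M) (Suc M)" for M
  have nV: "norm (V M) = 1" "norm (V M * x) = norm x" for M
    unfolding V_def by (simp_all add: norm_isometry norm_isometry_mult intertwiner_isometry)
  have "(\<lambda>M. norm (V M * x - \<alpha> x * V M) + norm (\<alpha> x)) \<longlonglongrightarrow> 0 + norm (\<alpha> x)"
    unfolding V_def by (intro tendsto_intros tendsto_norm_zero intertwiner_tendsto) simp
  moreover have "norm x \<le> norm (V M * x - \<alpha> x * V M) + norm (\<alpha> x)" for M
  proof -
    have "norm x = norm ((V M * x - \<alpha> x * V M) + \<alpha> x * V M)" using nV by simp
    also have "\<dots> \<le> norm (V M * x - \<alpha> x * V M) + norm (\<alpha> x * V M)" by (rule norm_triangle_ineq)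
    finally show ?thesis using norm_mult_ineq[of "\<alpha> x" "V M"] nV[of M] by simp
  qed
  ultimately show "norm x \<le> norm (\<alpha> x)"
    using LIMSEQ_le_const by fastforce
qed (rule star_endo_norm_le[OF endo])

end

end

section \<open>The vacuum inner product on the disk algebra\<close>

declare One_nat_def [simp del]

context cuntz
begin

section \<open>The disk algebra as the closure of the polynomials\<close>

definition disk :: "'a set" where
  "disk = closed_alg_gen cs (s ` {1..n})"

lemma s_in_disk: "i \<in> {1..n} \<Longrightarrow> s i \<in> disk"
  and one_in_disk: "1 \<in> disk"
  and closed_disk: "closed disk"
  and disk_add: "x \<in> disk \<Longrightarrow> y \<in> disk \<Longrightarrow> x + y \<in> disk"
  and disk_mult: "x \<in> disk \<Longrightarrow> y \<in> disk \<Longrightarrow> x * y \<in> disk"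
  and disk_cs: "x \<in> disk \<Longrightarrow> cs c x \<in> disk"
  unfolding disk_def closed_alg_gen_def by (auto intro!: closed_Inter)

lemma disk_minimal:
  assumes "\<And>i. i \<in> {1..n} \<Longrightarrow> s i \<in> B" "1 \<in> B" "closed B"
    "\<And>x y. x \<in> B \<Longrightarrow> y \<in> B \<Longrightarrow> x + y \<in> B" "\<And>x y. x \<in> B \<Longrightarrow> y \<in> B \<Longrightarrow> x * y \<in> B"
    "\<And>c x. x \<in> B \<Longrightarrow> cs c x \<in> B"
  shows "disk \<subseteq> B"
  unfolding disk_def closed_alg_gen_def using assms by (intro Inter_lower) auto

lemma disk_diff: "x \<in> disk \<Longrightarrow> y \<in> disk \<Longrightarrow> x - y \<in> disk"
  using disk_add[of x "- y"] disk_cs[of y "- 1"] by (simp add: cs_minus_left)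

lemma disk_0: "0 \<in> disk"
  using disk_cs[OF one_in_disk, of 0] by simp

lemma disk_sum: "(\<And>i. i \<in> I \<Longrightarrow> f i \<in> disk) \<Longrightarrow> sum f I \<in> disk"
  by (induction I rule: infinite_finite_induct) (auto intro: disk_add disk_0)

lemma W_in_disk: "set \<mu> \<subseteq> {1..n} \<Longrightarrow> W \<mu> \<in> disk"
  by (induction \<mu>) (auto simp: W_Cons intro!: disk_mult one_in_disk s_in_disk)

inductive_set polys :: "'a set" where
  polys_word: "set \<mu> \<subseteq> {1..n} \<Longrightarrow> cs c (W \<mu>) \<in> polys"
| polys_add: "x \<in> polys \<Longrightarrow> y \<in> polys \<Longrightarrow> x + y \<in> polys"

lemma polys_cs: "x \<in> polys \<Longrightarrow> cs c x \<in> polys"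
  by (induction rule: polys.induct) (auto simp: cs_cs cs_add intro: polys.intros)

lemma polys_mult:
  assumes "x \<in> polys" "y \<in> polys"
  shows "x * y \<in> polys"
  using assms(1)
proof (induction rule: polys.induct)
  case (polys_word \<mu> c)
  from assms(2) show ?case
  proof (induction rule: polys.induct)
    case (polys_word \<nu> d)
    thus ?case using \<open>set \<mu> \<subseteq> _\<close> polys.polys_word[of "\<mu> @ \<nu>"]
      by (simp add: cs_cs W_append)
  qed (simp add: ring_distribs polys_add)
qed (simp add: ring_distribs polys_add)

lemma polys_subset_disk: "x \<in> polys \<Longrightarrow> x \<in> disk"
  by (induction rule: polys.induct) (auto intro: disk_cs disk_add W_in_disk)

lemma disk_eq_closure_polys: "disk = closure polys"
proof
  show "closure polys \<subseteq> disk"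
    using polys_subset_disk by (intro closure_minimal closed_disk) auto
  show "disk \<subseteq> closure polys"
  proof (rule disk_minimal)
    show "s i \<in> closure polys" if "i \<in> {1..n}" for i
      using polys_word[of "[i]" 1] closure_subset that by (auto simp: W_Cons)
    show "1 \<in> closure polys"
      using polys_word[of "[]" 1] closure_subset by auto
    fix x y assume "x \<in> closure polys" "y \<in> closure polys"
    then obtain f g where f: "\<And>k. f k \<in> polys" "f \<longlonglongrightarrow> x" and g: "\<And>k. g k \<in> polys" "g \<longlonglongrightarrow> y"
      by (auto simp: closure_sequential)
    show "x + y \<in> closure polys"
      unfolding closure_sequential using tendsto_add[OF f(2) g(2)] polys_add[OF f(1) g(1)]
      by (intro exI[of _ "\<lambda>k. f k + g k"]) auto
    show "x * y \<in> closure polys"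
      unfolding closure_sequential using tendsto_mult[OF f(2) g(2)] polys_mult[OF f(1) g(1)]
      by (intro exI[of _ "\<lambda>k. f k * g k"]) auto
    show "cs c x \<in> closure polys" for c
      unfolding closure_sequential using tendsto_cs[OF f(2), of c] polys_cs[OF f(1), of c]
      by (intro exI[of _ "\<lambda>k. cs c (f k)"]) auto
  qed simp
qed

lemma disk_approx:
  assumes "x \<in> disk"
  obtains f where "\<And>k. f k \<in> polys" "f \<longlonglongrightarrow> x"
  using assms by (auto simp: disk_eq_closure_polys closure_sequential)

text \<open>Words span a dense subspace. The rule has no case for products, so it suits properties
  that are linear but not multiplicative, such as formulas for inner products.\<close>

lemma disk_induct [consumes 1, case_names limit add word]:
  assumes x: "x \<in> disk"
    and limit: "\<And>f x. (\<And>k. f k \<in> disk) \<Longrightarrow> (\<And>k. Q (f k)) \<Longrightarrow> x \<in> disk \<Longrightarrow> f \<longlonglongrightarrow> x \<Longrightarrow> Q x"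
    and add: "\<And>x y. x \<in> disk \<Longrightarrow> y \<in> disk \<Longrightarrow> Q x \<Longrightarrow> Q y \<Longrightarrow> Q (x + y)"
    and word: "\<And>c \<mu>. set \<mu> \<subseteq> {1..n} \<Longrightarrow> Q (cs c (W \<mu>))"
  shows "Q x"
proof -
  have "Q p" if "p \<in> polys" for p
    using that by (induction rule: polys.induct) (auto intro: add word polys_subset_disk)
  thus ?thesis using disk_approx[OF x] limit[OF _ _ x] polys_subset_disk by metis
qed

section \<open>The vacuum functional and its sesquilinear form\<close>

definition vac :: "nat \<Rightarrow> 'a \<Rightarrow> 'a" where
  "vac L x = adj (aperiodic L) * x * aperiodic L"

text \<open>A relation, so that uniqueness, linearity and limits can be handled before existence;
  existence is then proved for \<open>adj a * b\<close> with \<open>a\<close>, \<open>b\<close> in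
  the disk algebra, which is all that \<open>ip\<close> uses.\<close>

definition has_omega :: "'a \<Rightarrow> complex \<Rightarrow> bool" where
  "has_omega x c \<longleftrightarrow> (\<lambda>L. vac L x) \<longlonglongrightarrow> cs c 1"

definition ip :: "'a \<Rightarrow> 'a \<Rightarrow> complex" where
  "ip a b = (THE c. has_omega (adj a * b) c)"

lemma norm_vac: "norm (vac L x) \<le> norm x"
  unfolding vac_def
  using order_trans[OF norm_mult_ineq mult_right_mono[OF norm_mult_ineq norm_ge_zero]]
    norm_aperiodic by (metis mult.left_neutral mult.right_neutral norm_adj)

lemma vac_diff: "vac L x - vac L y = vac L (x - y)"
  by (simp add: vac_def algebra_simps)

lemma has_omega_unique:
  assumes "has_omega x c" "has_omega x d"
  shows "c = d"
proof -
  have "cs (c - d) 1 = 0"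
    using LIMSEQ_unique[OF assms[unfolded has_omega_def]] by (simp add: cs_diff_left)
  hence "cmod (c - d) = 0" using norm_cs[of "c - d" 1] by simp
  thus ?thesis by simp
qed

lemma has_omega_bound: "has_omega x c \<Longrightarrow> cmod c \<le> norm x"
  using Lim_bounded[OF tendsto_norm, of "\<lambda>L. vac L x" "cs c 1" 0 "norm x"] norm_vac
  by (simp add: has_omega_def norm_cs)

lemma has_omega_add: "has_omega x c \<Longrightarrow> has_omega y d \<Longrightarrow> has_omega (x + y) (c + d)"
  using tendsto_add[of "\<lambda>L. vac L x" "cs c 1" _ "\<lambda>L. vac L y" "cs d 1"]
  by (simp add: has_omega_def vac_def ring_distribs cs_add_left)

lemma has_omega_cs: "has_omega x c \<Longrightarrow> has_omega (cs d x) (d * c)"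
  using tendsto_cs[of "\<lambda>L. vac L x" "cs c 1" _ d]
  by (simp add: has_omega_def vac_def cs_cs)

lemma has_omega_diff: "has_omega x c \<Longrightarrow> has_omega y d \<Longrightarrow> has_omega (x - y) (c - d)"
  using has_omega_add[of x c "cs (- 1) y" "- d"] has_omega_cs[of y d "- 1"] by (simp add: cs_minus_left)

lemma has_omega_adj: "has_omega x c \<Longrightarrow> has_omega (adj x) (cnj c)"
  using tendsto_adj[of "\<lambda>L. vac L x" "cs c 1"]
  by (simp add: has_omega_def vac_def adj_mult adj_cs mult.assoc)

lemma has_omega_limit:
  assumes f: "\<And>k. has_omega (f k) (c k)" and lim: "f \<longlonglongrightarrow> x"
  obtains d where "has_omega x d" "c \<longlonglongrightarrow> d"
proof -
  have cd: "cmod (c k - c j) \<le> norm (f k - f j)" for k j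
    using has_omega_bound[OF has_omega_diff[OF f f]] .
  have "Cauchy c"
  proof (rule metric_CauchyI)
    fix e :: real assume "e > 0"
    then obtain M where "\<forall>m\<ge>M. \<forall>j\<ge>M. dist (f m) (f j) < e"
      using metric_CauchyD[OF LIMSEQ_imp_Cauchy[OF lim]] by meson
    thus "\<exists>M. \<forall>m\<ge>M. \<forall>j\<ge>M. dist (c m) (c j) < e"
      using cd by (metis dist_norm le_less_trans)
  qed
  then obtain d where d: "c \<longlonglongrightarrow> d" using Cauchy_convergent_iff convergent_def by blast
  have "has_omega x d"
    unfolding has_omega_def
  proof (rule LIMSEQ_I)
    fix r :: real assume "r > 0"
    obtain k1 where k1: "\<And>k. k \<ge> k1 \<Longrightarrow> norm (f k - x) < r / 3"
      using LIMSEQ_D[OF lim, of "r / 3"] \<open>r > 0\<close> by auto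
    obtain k2 where k2: "\<And>k. k \<ge> k2 \<Longrightarrow> norm (c k - d) < r / 3"
      using LIMSEQ_D[OF d, of "r / 3"] \<open>r > 0\<close> by auto
    define k where "k = max k1 k2"
    obtain L0 where L0: "\<And>L. L \<ge> L0 \<Longrightarrow> norm (vac L (f k) - cs (c k) 1) < r / 3"
      using LIMSEQ_D[OF f[of k, unfolded has_omega_def], of "r / 3"] \<open>r > 0\<close> by auto
    have "norm (vac L x - cs d 1) < r" if "L \<ge> L0" for L
    proof -
      have "vac L x - cs d 1
          = (vac L (f k) - cs (c k) 1) - vac L (f k - x) + cs (c k - d) 1"
        by (simp add: cs_diff_left flip: vac_diff)
      also have "norm \<dots> \<le> norm (vac L (f k) - cs (c k) 1) + norm (vac L (f k - x)) + norm (cs (c k - d) 1)"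
        by (meson add_mono norm_triangle_ineq norm_triangle_ineq4 order_refl order_trans)
      also have "\<dots> < r / 3 + r / 3 + r / 3"
        using L0[OF that] k1[of k] k2[of k] norm_vac[of L "f k - x"]
        by (intro add_strict_mono) (auto simp: norm_cs k_def)
      finally show ?thesis by simp
    qed
    thus "\<exists>L0. \<forall>L\<ge>L0. norm (vac L x - cs d 1) < r" by blast
  qed
  with d show ?thesis using that by blast
qed

lemma has_omega_W:
  assumes "set \<mu> \<subseteq> {1..n}" "set \<nu> \<subseteq> {1..n}"
  shows "has_omega (adj (W \<mu>) * W \<nu>) (if \<mu> = \<nu> then 1 else 0)"
proof -
  have "\<forall>\<^sub>F L in sequentially. vac L (adj (W \<mu>) * W \<nu>) = cs (if \<mu> = \<nu> then 1 else 0) 1"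
    using eventually_ge_at_top[of "max (length \<mu>) (length \<nu>)"]
  proof eventually_elim
    case (elim L)
    thus ?case using aperiodic_orthonormal[OF assms, of L]
      by (simp add: vac_def adj_mult mult.assoc)
  qed
  thus ?thesis unfolding has_omega_def by (rule tendsto_eventually)
qed

lemma has_omega_ip:
  assumes "a \<in> disk" "b \<in> disk"
  shows "has_omega (adj a * b) (ip a b)"
proof -
  have 1: "\<exists>c. has_omega (adj (W \<mu>) * b) c" if "b \<in> disk" "set \<mu> \<subseteq> {1..n}" for b \<mu>
    using that(1)
  proof (induction rule: disk_induct)
    case (limit f x)
    from limit.IH obtain c where "\<And>k. has_omega (adj (W \<mu>) * f k) (c k)" by metis
    from has_omega_limit[OF this tendsto_mult_left[OF limit.hyps(3)]] show ?case by metis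
  next
    case (add x y) thus ?case by (auto simp: ring_distribs intro: has_omega_add)
  next
    case (word c \<nu>)
    thus ?case using has_omega_cs[OF has_omega_W[OF that(2) word], of c] by auto
  qed
  have "\<exists>c. has_omega (adj a * b) c"
    using assms(1)
  proof (induction rule: disk_induct)
    case (limit f x)
    from limit.IH obtain c where "\<And>k. has_omega (adj (f k) * b) (c k)" by metis
    from has_omega_limit[OF this tendsto_mult_right[OF tendsto_adj[OF limit.hyps(3)]]] show ?case by metis
  next
    case (add x y) thus ?case by (auto simp: ring_distribs adj_add intro: has_omega_add)
  next
    case (word c \<nu>)
    then obtain d where "has_omega (adj (W \<nu>) * b) d" using 1[OF assms(2)] by blast
    from has_omega_cs[OF this, of "cnj c"] show ?case by (auto simp: adj_cs)
  qed
  thus ?thesis unfolding ip_def by (metis has_omega_unique theI)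
qed

lemma ip_eqI: "a \<in> disk \<Longrightarrow> b \<in> disk \<Longrightarrow> has_omega (adj a * b) c \<Longrightarrow> ip a b = c"
  using has_omega_ip has_omega_unique by blast

lemma ip_add_right: "a \<in> disk \<Longrightarrow> b \<in> disk \<Longrightarrow> c \<in> disk \<Longrightarrow> ip a (b + c) = ip a b + ip a c"
  by (intro ip_eqI) (auto simp: ring_distribs intro: has_omega_add has_omega_ip disk_add)

lemma ip_cs_right: "a \<in> disk \<Longrightarrow> b \<in> disk \<Longrightarrow> ip a (cs d b) = d * ip a b"
  by (intro ip_eqI) (auto intro: has_omega_cs has_omega_ip disk_cs)

lemma ip_commute: "a \<in> disk \<Longrightarrow> b \<in> disk \<Longrightarrow> ip b a = cnj (ip a b)"
  using has_omega_adj[OF has_omega_ip[of a b]] by (intro ip_eqI) (auto simp: adj_mult)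

lemma ip_diff_right: "a \<in> disk \<Longrightarrow> b \<in> disk \<Longrightarrow> c \<in> disk \<Longrightarrow> ip a (b - c) = ip a b - ip a c"
  by (intro ip_eqI) (auto simp: algebra_simps intro: has_omega_diff has_omega_ip disk_diff)

lemma ip_add_left: "a \<in> disk \<Longrightarrow> b \<in> disk \<Longrightarrow> c \<in> disk \<Longrightarrow> ip (b + c) a = ip b a + ip c a"
  by (intro ip_eqI) (auto simp: ring_distribs adj_add intro: has_omega_add has_omega_ip disk_add)

lemma ip_cs_left: "a \<in> disk \<Longrightarrow> b \<in> disk \<Longrightarrow> ip (cs d b) a = cnj d * ip b a"
  by (intro ip_eqI) (auto simp: adj_cs intro: has_omega_cs has_omega_ip disk_cs)

lemma ip_diff_left: "a \<in> disk \<Longrightarrow> b \<in> disk \<Longrightarrow> c \<in> disk \<Longrightarrow> ip (b - c) a = ip b a - ip c a"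
  by (intro ip_eqI) (auto simp: algebra_simps adj_diff intro: has_omega_diff has_omega_ip disk_diff)

lemma ip_0_right: "a \<in> disk \<Longrightarrow> ip a 0 = 0"
  using ip_cs_right[OF _ disk_0, of a 0] by simp

lemma ip_0_left: "a \<in> disk \<Longrightarrow> ip 0 a = 0"
  using ip_cs_left[OF _ disk_0, of a 0] by simp

lemma ip_sum_right:
  "a \<in> disk \<Longrightarrow> (\<And>i. i \<in> I \<Longrightarrow> f i \<in> disk) \<Longrightarrow> ip a (sum f I) = (\<Sum>i\<in>I. ip a (f i))"
  by (induction I rule: infinite_finite_induct) (auto simp: ip_0_right ip_add_right disk_sum)

lemma ip_sum_left:
  "a \<in> disk \<Longrightarrow> (\<And>i. i \<in> I \<Longrightarrow> f i \<in> disk) \<Longrightarrow> ip (sum f I) a = (\<Sum>i\<in>I. ip (f i) a)"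
  by (induction I rule: infinite_finite_induct) (auto simp: ip_0_left ip_add_left disk_sum)

lemma ip_W_W: "set \<mu> \<subseteq> {1..n} \<Longrightarrow> set \<nu> \<subseteq> {1..n} \<Longrightarrow> ip (W \<mu>) (W \<nu>) = (if \<mu> = \<nu> then 1 else 0)"
  using has_omega_W by (intro ip_eqI W_in_disk) auto

lemma ip_bound: "a \<in> disk \<Longrightarrow> b \<in> disk \<Longrightarrow> cmod (ip a b) \<le> norm a * norm b"
  using has_omega_bound[OF has_omega_ip[of a b]] norm_mult_ineq[of "adj a" b] by simp

lemma ip_tendsto:
  assumes "\<And>k. f k \<in> disk" "\<And>k. g k \<in> disk" "f \<longlonglongrightarrow> x" "g \<longlonglongrightarrow> y"
  shows "(\<lambda>k. ip (f k) (g k)) \<longlonglongrightarrow> ip x y"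
proof -
  have xy: "x \<in> disk" "y \<in> disk"
    using assms closed_disk closed_sequentially by blast+
  obtain d where "has_omega (adj x * y) d" "(\<lambda>k. ip (f k) (g k)) \<longlonglongrightarrow> d"
    using has_omega_limit[OF has_omega_ip[OF assms(1,2)] tendsto_mult[OF tendsto_adj[OF assms(3)] assms(4)]]
    by metis
  thus ?thesis using ip_eqI[OF xy] by blast
qed

text \<open>\<open>ip\<close> sees only \<open>adj a * b\<close>, from which the isometry cancels.
  Applied to the \<open>t i\<close>, this makes left multiplication isometric for the vacuum
  product, the reason why the cyclic modules are free.\<close>

lemma ip_mult_isometry: "adj t * t = 1 \<Longrightarrow> ip (t * a) (t * b) = ip a b"
proof -
  assume "adj t * t = 1"
  moreover have "adj (t * a) * (t * b) = adj a * (adj t * t) * b" by (simp add: adj_mult mult.assoc)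
  ultimately have "adj (t * a) * (t * b) = adj a * b" by simp
  thus ?thesis by (simp add: ip_def)
qed

lemma ip_mult_orthogonal:
  assumes "a \<in> disk" "b \<in> disk" "t \<in> disk" "u \<in> disk" "adj t * u = 0"
  shows "ip (t * a) (u * b) = 0"
proof (rule ip_eqI)
  have "adj (t * a) * (u * b) = adj a * (adj t * u) * b" by (simp add: adj_mult mult.assoc)
  hence "adj (t * a) * (u * b) = 0" using assms(5) by simp
  thus "has_omega (adj (t * a) * (u * b)) 0" by (simp add: has_omega_def vac_def)
qed (use assms disk_mult in auto)

section \<open>Fourier coefficients and the Parseval identity\<close>

definition nrm2 :: "'a \<Rightarrow> real" where
  "nrm2 a = Re (ip a a)"

definition trunc :: "nat \<Rightarrow> 'a \<Rightarrow> 'a" where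
  "trunc N a = (\<Sum>m<N. \<Sum>\<mu>\<in>wds m. cs (ip (W \<mu>) a) (W \<mu>))"

definition energy :: "'a \<Rightarrow> nat \<Rightarrow> real" where
  "energy a m = (\<Sum>\<mu>\<in>wds m. (cmod (ip (W \<mu>) a))\<^sup>2)"

lemma ip_self: "a \<in> disk \<Longrightarrow> ip a a = complex_of_real (nrm2 a)"
  using ip_commute[of a a] by (auto simp: nrm2_def complex_eq_iff)

lemma wdsD: "\<mu> \<in> wds m \<Longrightarrow> set \<mu> \<subseteq> {1..n}"
  by (simp add: wds_def)

lemma trunc_in_disk: "trunc N a \<in> disk"
  unfolding trunc_def by (intro disk_sum disk_cs W_in_disk wdsD)

lemma W_wds_in_disk: "\<mu> \<in> wds m \<Longrightarrow> W \<mu> \<in> disk"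
  by (intro W_in_disk wdsD)

lemma ip_trunc_right:
  assumes "b \<in> disk"
  shows "ip b (trunc N a) = (\<Sum>m<N. \<Sum>\<nu>\<in>wds m. ip (W \<nu>) a * ip b (W \<nu>))"
proof -
  have "ip b (trunc N a) = (\<Sum>m<N. ip b (\<Sum>\<nu>\<in>wds m. cs (ip (W \<nu>) a) (W \<nu>)))"
    unfolding trunc_def by (intro ip_sum_right disk_sum disk_cs assms W_wds_in_disk)
  also have "\<dots> = (\<Sum>m<N. \<Sum>\<nu>\<in>wds m. ip b (cs (ip (W \<nu>) a) (W \<nu>)))"
    by (intro sum.cong refl ip_sum_right disk_cs assms W_wds_in_disk)
  also have "\<dots> = (\<Sum>m<N. \<Sum>\<nu>\<in>wds m. ip (W \<nu>) a * ip b (W \<nu>))"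
    by (intro sum.cong refl ip_cs_right assms W_wds_in_disk)
  finally show ?thesis .
qed

lemma ip_W_trunc:
  assumes "\<mu> \<in> wds m" "m < N"
  shows "ip (W \<mu>) (trunc N a) = ip (W \<mu>) a"
proof -
  have "ip (W \<mu>) (trunc N a) = (\<Sum>k<N. \<Sum>\<nu>\<in>wds k. ip (W \<nu>) a * (if \<mu> = \<nu> then 1 else 0))"
    unfolding ip_trunc_right[OF W_wds_in_disk[OF assms(1)]]
    by (intro sum.cong refl arg_cong2[of _ _ _ _ "(*)"] ip_W_W wdsD[OF assms(1)] wdsD)
  also have "\<dots> = (\<Sum>k<N. if k = m then ip (W \<mu>) a else 0)"
  proof (intro sum.cong refl)
    fix k
    show "(\<Sum>\<nu>\<in>wds k. ip (W \<nu>) a * (if \<mu> = \<nu> then 1 else 0)) = (if k = m then ip (W \<mu>) a else 0)"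
    proof -
      have "(\<Sum>\<nu>\<in>wds k. ip (W \<nu>) a * (if \<mu> = \<nu> then 1 else 0))
          = (if \<mu> \<in> wds k then ip (W \<mu>) a else 0)"
        by (simp add: if_distrib[of "\<lambda>x. _ * x"] sum.delta' cong: if_cong)
      moreover have "\<mu> \<in> wds k \<longleftrightarrow> k = m" using assms(1) by (auto simp: wds_def)
      ultimately show ?thesis by simp
    qed
  qed
  finally show ?thesis using assms by simp
qed

text \<open>Only the coefficients of \<open>b\<close> in degrees below \<open>N\<close> matter.
  Asking that they agree with those of \<open>a\<close> covers both \<open>b = a\<close> and
  \<open>b = trunc N a\<close>, the two products in the Pythagorean identity.\<close>

lemma ip_trunc:
  assumes "b \<in> disk" "\<And>m \<mu>. m < N \<Longrightarrow> \<mu> \<in> wds m \<Longrightarrow> ip (W \<mu>) b = ip (W \<mu>) a"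
  shows "ip (trunc N a) b = complex_of_real (\<Sum>m<N. energy a m)"
proof -
  have "ip (trunc N a) b = (\<Sum>m<N. \<Sum>\<mu>\<in>wds m. cnj (ip (W \<mu>) a) * cnj (ip b (W \<mu>)))"
    using ip_commute[OF assms(1) trunc_in_disk] ip_trunc_right[OF assms(1)] by simp
  also have "\<dots> = (\<Sum>m<N. \<Sum>\<mu>\<in>wds m. cnj (ip (W \<mu>) a) * ip (W \<mu>) b)"
    by (intro sum.cong refl arg_cong2[of _ _ _ _ "(*)"] ip_commute[symmetric] assms(1) W_wds_in_disk)
  also have "\<dots> = (\<Sum>m<N. \<Sum>\<mu>\<in>wds m. complex_of_real ((cmod (ip (W \<mu>) a))\<^sup>2))"
    by (intro sum.cong refl) (simp add: assms(2) complex_norm_square mult.commute del: of_real_power)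
  finally show ?thesis by (simp add: energy_def)
qed

lemma nrm2_diff_trunc:
  assumes "a \<in> disk"
  shows "nrm2 (a - trunc N a) = nrm2 a - (\<Sum>m<N. energy a m)"
proof -
  define T where "T = trunc N a"
  have T: "T \<in> disk" by (simp add: T_def trunc_in_disk)
  have 1: "ip T a = complex_of_real (\<Sum>m<N. energy a m)"
    unfolding T_def using assms by (intro ip_trunc) auto
  have 2: "ip T T = complex_of_real (\<Sum>m<N. energy a m)"
    unfolding T_def by (intro ip_trunc trunc_in_disk ip_W_trunc)
  have "ip (a - T) (a - T) = ip a a - ip T a - (ip a T - ip T T)"
    using assms T by (simp add: ip_diff_left ip_diff_right disk_diff)
  also have "ip a T = cnj (ip T a)" using ip_commute[OF T assms] .
  finally show ?thesis by (simp add: 1 2 nrm2_def flip: T_def)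
qed

lemma trunc_add: "a \<in> disk \<Longrightarrow> b \<in> disk \<Longrightarrow> trunc N (a + b) = trunc N a + trunc N b"
  unfolding trunc_def sum.distrib[symmetric]
  by (intro sum.cong refl) (simp add: ip_add_right[OF W_wds_in_disk] cs_add_left)

lemma trunc_diff: "a \<in> disk \<Longrightarrow> b \<in> disk \<Longrightarrow> trunc N (a - b) = trunc N a - trunc N b"
  unfolding trunc_def sum_subtractf[symmetric]
  by (intro sum.cong refl) (simp add: ip_diff_right[OF W_wds_in_disk] cs_diff_left)

lemma trunc_polys: "p \<in> polys \<Longrightarrow> \<exists>N0. \<forall>N\<ge>N0. trunc N p = p"
proof (induction rule: polys.induct)
  case (polys_word \<mu> c)
  have "trunc N (cs c (W \<mu>)) = cs c (W \<mu>)" if "length \<mu> < N" for N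
  proof -
    have "trunc N (cs c (W \<mu>)) = (\<Sum>m<N. \<Sum>\<nu>\<in>wds m. if \<nu> = \<mu> then cs c (W \<mu>) else 0)"
      unfolding trunc_def
    proof (intro sum.cong refl)
      fix m \<nu> assume "\<nu> \<in> wds m"
      hence "set \<nu> \<subseteq> {1..n}" by (rule wdsD)
      hence "ip (W \<nu>) (cs c (W \<mu>)) = c * (if \<nu> = \<mu> then 1 else 0)"
        using polys_word by (simp add: ip_cs_right W_in_disk ip_W_W)
      thus "cs (ip (W \<nu>) (cs c (W \<mu>))) (W \<nu>) = (if \<nu> = \<mu> then cs c (W \<mu>) else 0)" by simp
    qed
    also have "\<dots> = (\<Sum>m<N. if m = length \<mu> then cs c (W \<mu>) else 0)"
    proof (intro sum.cong refl)
      fix m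
      have "\<mu> \<in> wds m \<longleftrightarrow> m = length \<mu>" using polys_word by (auto simp: wds_def)
      thus "(\<Sum>\<nu>\<in>wds m. if \<nu> = \<mu> then cs c (W \<mu>) else 0) = (if m = length \<mu> then cs c (W \<mu>) else 0)"
        by (simp add: sum.delta)
    qed
    finally show ?thesis using that by simp
  qed
  thus ?case by (metis Suc_le_eq)
next
  case (polys_add x y)
  then obtain N1 N2 where "\<forall>N\<ge>N1. trunc N x = x" "\<forall>N\<ge>N2. trunc N y = y" by blast
  thus ?case using polys_add.hyps
    by (intro exI[of _ "max N1 N2"]) (auto simp: trunc_add polys_subset_disk)
qed

lemma energy_nonneg: "energy a m \<ge> 0"
  by (simp add: energy_def sum_nonneg)

text \<open>By density: a polynomial equals its truncations of high order, so its
  \<open>nrm2\<close> is a finite sum of squared coefficients, and \<open>ip\<close> is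
  continuous.\<close>

lemma nrm2_nonneg:
  assumes "a \<in> disk"
  shows "nrm2 a \<ge> 0"
proof -
  have p: "nrm2 p \<ge> 0" if pp: "p \<in> polys" for p
  proof -
    obtain N where "trunc N p = p" using trunc_polys[OF pp] by blast
    hence "nrm2 p = (\<Sum>m<N. energy p m)"
      using nrm2_diff_trunc[of p N] pp by (simp add: polys_subset_disk nrm2_def ip_0_right disk_0)
    thus ?thesis by (simp add: sum_nonneg energy_nonneg)
  qed
  obtain f where f: "\<And>k. f k \<in> polys" "f \<longlonglongrightarrow> a" using disk_approx[OF assms] by blast
  have "(\<lambda>k. nrm2 (f k)) \<longlonglongrightarrow> nrm2 a"
    unfolding nrm2_def using f polys_subset_disk by (intro tendsto_Re ip_tendsto) auto
  thus ?thesis using p f by (intro LIMSEQ_le_const) auto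
qed

lemma nrm2_le: "a \<in> disk \<Longrightarrow> nrm2 a \<le> (norm a)\<^sup>2"
  using ip_bound[of a a] complex_Re_le_cmod[of "ip a a"] by (simp add: nrm2_def power2_eq_square)

lemma sum_energy_le: "a \<in> disk \<Longrightarrow> (\<Sum>m<N. energy a m) \<le> nrm2 a"
  using nrm2_nonneg[of "a - trunc N a"] nrm2_diff_trunc[of a N] by (simp add: disk_diff trunc_in_disk)

text \<open>Take a polynomial \<open>p\<close> close to \<open>a\<close> in norm. Truncations of
  high order leave \<open>p\<close> alone, so \<open>a\<close> and \<open>a - p\<close> have the
  same remainder, whose \<open>nrm2\<close> is at most \<open>nrm2 (a - p)\<close>.\<close>

lemma parseval:
  assumes a: "a \<in> disk"
  shows "energy a sums nrm2 a"
  unfolding sums_def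
proof (rule LIMSEQ_I)
  fix r :: real assume r: "r > 0"
  obtain f where f: "\<And>k. f k \<in> polys" "f \<longlonglongrightarrow> a" using disk_approx[OF a] by blast
  then obtain k where "norm (f k - a) < sqrt r" using LIMSEQ_D[OF f(2), of "sqrt r"] r by auto
  moreover define p where "p = f k"
  ultimately have "(norm (a - p))\<^sup>2 < (sqrt r)\<^sup>2"
    by (intro power_strict_mono) (auto simp: norm_minus_commute)
  hence p: "p \<in> disk" "nrm2 (a - p) < r"
    using nrm2_le[of "a - p"] r f a by (auto simp: p_def polys_subset_disk disk_diff)
  obtain N0 where N0: "\<And>N. N \<ge> N0 \<Longrightarrow> trunc N p = p"
    using trunc_polys f p_def by blast
  have "norm ((\<Sum>m<N. energy a m) - nrm2 a) < r" if "N \<ge> N0" for N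
  proof -
    have eq: "(a - p) - trunc N (a - p) = a - trunc N a"
      using N0[OF that] a p by (simp add: trunc_diff)
    have "nrm2 a - (\<Sum>m<N. energy a m) = nrm2 (a - p) - (\<Sum>m<N. energy (a - p) m)"
      using nrm2_diff_trunc[OF a, of N] nrm2_diff_trunc[OF disk_diff[OF a p(1)], of N]
      unfolding eq by simp
    also have "\<dots> < r" using p(2) sum_nonneg[of "{..<N}" "energy (a - p)"] energy_nonneg by fastforce
    finally show ?thesis using sum_energy_le[OF a, of N] by simp
  qed
  thus "\<exists>N0. \<forall>N\<ge>N0. norm ((\<Sum>m<N. energy a m) - nrm2 a) < r" by blast
qed

lemma coefficient_eq_0:
  assumes "a \<in> disk" "nrm2 a = 0" "set \<mu> \<subseteq> {1..n}"
  shows "ip (W \<mu>) a = 0"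
proof -
  define m where "m = length \<mu>"
  have "\<mu> \<in> wds m" using assms by (simp add: wds_def m_def)
  hence "(cmod (ip (W \<mu>) a))\<^sup>2 \<le> energy a m"
    unfolding energy_def by (intro member_le_sum) auto
  also have "\<dots> \<le> (\<Sum>k<Suc m. energy a k)"
    by (simp add: sum_nonneg energy_nonneg)
  also have "\<dots> \<le> 0" using sum_energy_le[OF assms(1), of "Suc m"] assms(2) by simp
  finally show ?thesis by simp
qed

text \<open>Right multiplication by \<open>W \<rho>\<close> appends \<open>\<rho>\<close> to each
  word of the expansion of \<open>a\<close>. When \<open>\<rho>\<close> is longer than
  \<open>\<mu>\<close>, the truncated difference is 0 and \<open>drop 0 \<mu> = \<mu>\<close>
  differs from \<open>\<rho>\<close>, so the value is 0 as it should be.\<close>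

lemma ip_W_mult_W:
  assumes "a \<in> disk" "set \<mu> \<subseteq> {1..n}" "set \<rho> \<subseteq> {1..n}"
  shows "ip (W \<mu>) (a * W \<rho>) =
    (if drop (length \<mu> - length \<rho>) \<mu> = \<rho> then ip (W (take (length \<mu> - length \<rho>) \<mu>)) a else 0)"
  using assms(1)
proof (induction rule: disk_induct)
  case (limit f x)
  have W: "W \<mu> \<in> disk" "W \<rho> \<in> disk" "W (take (length \<mu> - length \<rho>) \<mu>) \<in> disk"
    using assms set_take_subset[of _ \<mu>] by (auto intro!: W_in_disk dest: in_set_takeD)
  have "(\<lambda>k. ip (W \<mu>) (f k * W \<rho>)) \<longlonglongrightarrow> ip (W \<mu>) (x * W \<rho>)"
    using limit W by (intro ip_tendsto disk_mult tendsto_intros) auto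
  moreover have "(\<lambda>k. ip (W (take (length \<mu> - length \<rho>) \<mu>)) (f k)) \<longlonglongrightarrow> ip (W (take (length \<mu> - length \<rho>) \<mu>)) x"
    using limit W by (intro ip_tendsto tendsto_intros) auto
  ultimately show ?case
    unfolding limit.IH by (auto intro: LIMSEQ_unique split: if_splits)
next
  case (add x y)
  have W: "W \<mu> \<in> disk" "W \<rho> \<in> disk" "W (take (length \<mu> - length \<rho>) \<mu>) \<in> disk"
    using assms set_take_subset[of _ \<mu>] by (auto intro!: W_in_disk dest: in_set_takeD)
  thus ?case using add by (simp add: ring_distribs ip_add_right disk_mult)
next
  case (word c \<sigma>)
  have t: "set (take (length \<mu> - length \<rho>) \<mu>) \<subseteq> {1..n}"
    using assms set_take_subset[of _ \<mu>] by blast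
  have *: "\<mu> = \<sigma> @ \<rho> \<longleftrightarrow> drop (length \<mu> - length \<rho>) \<mu> = \<rho> \<and> take (length \<mu> - length \<rho>) \<mu> = \<sigma>"
    by (metis append_eq_conv_conj append_take_drop_id diff_add_inverse2 length_append)
  have "ip (W \<mu>) (cs c (W \<sigma>) * W \<rho>) = c * ip (W \<mu>) (W (\<sigma> @ \<rho>))"
    using assms word by (simp add: W_append[symmetric] ip_cs_right W_in_disk)
  thus ?case using assms word t * by (auto simp: ip_W_W ip_cs_right W_in_disk)
qed

lemma vac_tendsto_ip:
  "a \<in> disk \<Longrightarrow> b \<in> disk \<Longrightarrow> (\<lambda>L. vac L (adj a * b)) \<longlonglongrightarrow> cs (ip a b) 1"
  using has_omega_ip by (simp add: has_omega_def)

text \<open>Vanishing \<open>nrm2\<close> directly kills only the Fourier coefficients. To reach the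
  norm, \<open>a\<close> is compressed by the averaged isometries of the identity map: the
  compression is a finite combination of vacuum terms that tend to 0 as \<open>L\<close> grows with
  \<open>M\<close> fixed, and it is close to \<open>a\<close> because these isometries almost
  commute with \<open>a\<close>. Since \<open>L\<close> is chosen after \<open>M\<close>, it enters
  \<open>intertwiner_tendsto\<close> as a function of \<open>M\<close>.\<close>

lemma nrm2_eq_0_imp:
  assumes a: "a \<in> disk" and a0: "nrm2 a = 0"
  shows "a = 0"
proof -
  have id: "unital_star_endo cs adj (\<lambda>x. x)" by (simp add: unital_star_endo_def)
  define V where "V = intertwiner (\<lambda>x. x)"
  have lim: "(\<lambda>L. adj (V M L) * a * V M L) \<longlonglongrightarrow> 0" for M
  proof -
    have "(\<lambda>L. W \<mu> * vac L (adj (W \<mu>) * (a * W \<nu>)) * adj (W \<nu>)) \<longlonglongrightarrow> 0"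
      if mn: "\<mu> \<in> wds m" "\<nu> \<in> wds k" for \<mu> \<nu> m k
    proof -
      have "ip (W \<mu>) (a * W \<nu>) = 0"
        using ip_W_mult_W[OF a wdsD[OF mn(1)] wdsD[OF mn(2)]]
          coefficient_eq_0[OF a a0, of "take (length \<mu> - length \<nu>) \<mu>"]
          wdsD[OF mn(1)] set_take_subset[of _ \<mu>] by (metis subset_trans)
      hence "(\<lambda>L. vac L (adj (W \<mu>) * (a * W \<nu>))) \<longlonglongrightarrow> 0"
        using vac_tendsto_ip[OF W_wds_in_disk[OF mn(1)] disk_mult[OF a W_wds_in_disk[OF mn(2)]]]
        by simp
      from tendsto_mult_right[OF tendsto_mult_left[OF this, of "W \<mu>"], of "adj (W \<nu>)"]
      show ?thesis by simp
    qed
    hence "(\<lambda>L. (1 / real M) *\<^sub>R (\<Sum>m<M. \<Sum>k<M. \<Sum>\<mu>\<in>wds m. \<Sum>\<nu>\<in>wds k.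
        W \<mu> * vac L (adj (W \<mu>) * (a * W \<nu>)) * adj (W \<nu>)))
      \<longlonglongrightarrow> (1 / real M) *\<^sub>R (\<Sum>m<M. \<Sum>k<M. \<Sum>\<mu>\<in>wds m. \<Sum>\<nu>\<in>wds k. 0)"
      by (intro tendsto_intros)
    moreover have "adj (V M L) * a * V M L = (1 / real M) *\<^sub>R (\<Sum>m<M. \<Sum>k<M. \<Sum>\<mu>\<in>wds m. \<Sum>\<nu>\<in>wds k.
        W \<mu> * vac L (adj (W \<mu>) * (a * W \<nu>)) * adj (W \<nu>))" for L
    proof -
      have "adj (level (\<lambda>x. x) L m) * a * level (\<lambda>x. x) L k = (\<Sum>\<mu>\<in>wds m. \<Sum>\<nu>\<in>wds k.
          W \<mu> * vac L (adj (W \<mu>) * (a * W \<nu>)) * adj (W \<nu>))" for m k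
        by (simp add: level_def adj_sum adj_mult sum_product sum_distrib_right sum_distrib_left vac_def mult.assoc)
          (rule sum.swap)
      moreover have "adj (\<Sum>m<M. level (\<lambda>x. x) L m) * a * (\<Sum>m<M. level (\<lambda>x. x) L m)
          = (\<Sum>m<M. \<Sum>k<M. adj (level (\<lambda>x. x) L m) * a * level (\<lambda>x. x) L k)"
        by (simp add: adj_sum sum_distrib_left sum_distrib_right) (rule sum.swap)
      moreover have "adj (V M L) * a * V M L = (1 / real M) *\<^sub>R
          (adj (\<Sum>m<M. level (\<lambda>x. x) L m) * a * (\<Sum>m<M. level (\<lambda>x. x) L m))"
        by (simp add: V_def intertwiner_def adj_scaleR)
      ultimately show ?thesis by simp
    qed
    ultimately show ?thesis by simp
  qed
  have "\<exists>L\<ge>Suc M. norm (adj (V (Suc M) L) * a * V (Suc M) L) < 1 / real (Suc M)" for M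
  proof -
    obtain L0 where "\<And>L. L \<ge> L0 \<Longrightarrow> norm (adj (V (Suc M) L) * a * V (Suc M) L) < 1 / real (Suc M)"
      using LIMSEQ_D[OF lim[of "Suc M"], of "1 / real (Suc M)"] by auto
    thus ?thesis by (intro exI[of _ "max L0 (Suc M)"]) auto
  qed
  then obtain L where L: "\<And>M. Suc M \<le> L M"
    "\<And>M. norm (adj (V (Suc M) (L M)) * a * V (Suc M) (L M)) < 1 / real (Suc M)"
    by metis
  define U where "U M = V (Suc M) (L M)" for M
  have U: "adj (U M) * U M = 1" "norm (U M) = 1" for M
    using intertwiner_isometry[OF id, of "Suc M" "L M"] L(1) norm_isometry
    by (auto simp: U_def V_def)
  have "norm a \<le> norm (U M * a - a * U M) + 1 / real (Suc M)" for M
  proof -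
    have "a = adj (U M) * (U M * a - a * U M) + adj (U M) * a * U M"
      using U[of M] by (simp add: algebra_simps) (simp flip: mult.assoc)
    also have "norm \<dots> \<le> norm (adj (U M) * (U M * a - a * U M)) + norm (adj (U M) * a * U M)"
      by (rule norm_triangle_ineq)
    also have "\<dots> \<le> norm (U M * a - a * U M) + 1 / real (Suc M)"
      using norm_mult_ineq[of "adj (U M)" "U M * a - a * U M"] U(2)[of M] L(2)[of M]
      by (simp add: U_def)
    finally show ?thesis .
  qed
  moreover have "(\<lambda>M. norm (U M * a - a * U M) + 1 / real (Suc M)) \<longlonglongrightarrow> 0 + 0"
    using intertwiner_tendsto[OF id, of L a] L(1) unfolding U_def V_def
    by (intro tendsto_add tendsto_norm_zero LIMSEQ_Suc[OF lim_1_over_n]) auto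
  ultimately have "norm a \<le> 0" using LIMSEQ_le_const by fastforce
  thus ?thesis by simp
qed

end

section \<open>Row isometries in the disk algebra\<close>

text \<open>An Euler characteristic count: the right ideal generated by a row of \<open>n\<close> isometries with
  orthogonal ranges is free of rank \<open>n\<close>, and a right ideal of codimension \<open>k\<close> has rank
  \<open>k (n - 1) + 1\<close>, so \<open>k = 1\<close>.  Here \<open>S m\<close> is the trace, over words of length \<open>m\<close>, of the projection
  onto the cokernel, and \<open>f m\<close> is the mass of the generators in degree \<open>m\<close>.\<close>

lemma cokernel_mass:
  fixes f S :: "nat \<Rightarrow> real" and n :: real
  assumes n: "n > 1" and f: "\<And>m. f m \<ge> 0" "f sums n" and S: "\<And>m. S m \<ge> 0"
    and S_0: "S 0 = 1 - f 0" and S_Suc: "\<And>m. S (Suc m) = n * S m - f (Suc m)"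
    and lim: "(\<lambda>m. S m / n ^ m) \<longlonglongrightarrow> 0"
  shows "S sums 1" "S 0 > 0"
proof -
  \<comment> \<open>The recursion is run backwards,
    \<open>S m = (S (Suc m) + f (Suc m)) / n\<close>. The tail of \<open>f\<close> bounds
    \<open>S m\<close> up to a remainder that \<open>lim\<close> sends to 0, so \<open>S\<close>
    itself tends to 0.\<close>
  have bound: "S m \<le> (\<Sum>j<J. f (j + Suc m)) + S (m + J) / n ^ J" for m J
  proof (induction J)
    case (Suc J)
    have "S (m + J) = (S (Suc (m + J)) + f (Suc (m + J))) / n"
      using S_Suc[of "m + J"] n by (simp add: field_simps)
    hence "S (m + J) / n ^ J = f (J + Suc m) / n ^ Suc J + S (m + Suc J) / n ^ Suc J"
      by (simp add: add_divide_distrib add.commute)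
    also have "f (J + Suc m) / n ^ Suc J \<le> f (J + Suc m)"
    proof -
      have "1 \<le> n ^ Suc J" using n by (intro one_le_power) simp
      thus ?thesis using f(1)[of "J + Suc m"] mult_left_mono[of 1 "n ^ Suc J" "f (J + Suc m)"] n
        by (simp add: field_simps)
    qed
    finally show ?case using Suc by simp
  qed simp
  have "S m \<le> n - (\<Sum>j<Suc m. f j)" for m
  proof -
    have "(\<lambda>J. \<Sum>j<J. f (j + Suc m)) \<longlonglongrightarrow> n - (\<Sum>j<Suc m. f j)"
      using sums_split_initial_segment[OF f(2), of "Suc m"] by (simp add: sums_def)
    moreover have "(\<lambda>J. n ^ m * (S (J + m) / n ^ (J + m))) \<longlonglongrightarrow> n ^ m * 0"
      by (intro tendsto_intros LIMSEQ_ignore_initial_segment[OF lim])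
    ultimately have "(\<lambda>J. (\<Sum>j<J. f (j + Suc m)) + n ^ m * (S (J + m) / n ^ (J + m)))
        \<longlonglongrightarrow> n - (\<Sum>j<Suc m. f j) + n ^ m * 0"
      by (rule tendsto_add)
    moreover have "n ^ m * (S (J + m) / n ^ (J + m)) = S (m + J) / n ^ J" for J
      using n by (simp add: power_add add.commute)
    ultimately show ?thesis using bound LIMSEQ_le_const[of _ "n - (\<Sum>j<Suc m. f j)" "S m"] by auto
  qed
  moreover have "(\<lambda>m. n - (\<Sum>j<Suc m. f j)) \<longlonglongrightarrow> n - n"
    using f(2) by (intro tendsto_intros LIMSEQ_Suc) (simp add: sums_def)
  ultimately have S_lim: "S \<longlonglongrightarrow> 0"
    using S by (intro tendsto_sandwich[of "\<lambda>_. 0" S _ "\<lambda>m. n - (\<Sum>j<Suc m. f j)"]) auto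
  \<comment> \<open>The summed recursion. Letting \<open>N\<close> grow, \<open>S N\<close>
    disappears and the mass of \<open>f\<close> is \<open>n\<close>, so the total is
    \<open>(n - 1) / (n - 1)\<close>.\<close>
  have "(n - 1) * (\<Sum>m<N. S m) = S N - 1 + (\<Sum>j<Suc N. f j)" for N
    by (induction N) (simp_all add: S_0 S_Suc algebra_simps)
  hence "(\<Sum>m<N. S m) = (S N - 1 + (\<Sum>j<Suc N. f j)) / (n - 1)" for N
    using n by (simp add: field_simps)
  moreover have "(\<lambda>N. (S N - 1 + (\<Sum>j<Suc N. f j)) / (n - 1)) \<longlonglongrightarrow> (0 - 1 + n) / (n - 1)"
    using f(2) n S_lim by (intro tendsto_intros LIMSEQ_Suc) (simp_all add: sums_def)
  ultimately show 1: "S sums 1" using n by (simp add: sums_def)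
  \<comment> \<open>Once \<open>S\<close> is 0 the recursion keeps it there, since \<open>S\<close>
    and \<open>f\<close> are nonnegative; this would contradict the total mass 1.\<close>
  show "S 0 > 0"
  proof (rule ccontr)
    assume "\<not> S 0 > 0"
    have "S m = 0" for m
    proof (induction m)
      case 0 thus ?case using S[of 0] \<open>\<not> S 0 > 0\<close> by simp
    next
      case (Suc m) thus ?case using S[of "Suc m"] S_Suc[of m] f(1)[of "Suc m"] by simp
    qed
    hence "S = (\<lambda>_. 0)" by auto
    thus False using sums_unique2[OF 1, of 0] by (simp add: sums_zero)
  qed
qed

context cuntz
begin

text \<open>For a word \<open>t\<close>, the adjoint cancels against the beginning of
  \<open>W \<mu>\<close> as soon as \<open>\<mu>\<close> is at least as long, leaving a word or 0.
  Approximating a general \<open>t\<close> by polynomials costs an error independent of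
  \<open>\<mu>\<close>, because \<open>W \<mu>\<close> has norm 1.\<close>

lemma adj_mult_W_approx:
  assumes "t \<in> disk" "e > 0"
  shows "\<exists>N. \<forall>\<mu>. set \<mu> \<subseteq> {1..n} \<and> N \<le> length \<mu> \<longrightarrow> (\<exists>b\<in>disk. norm (adj t * W \<mu> - b) < e)"
  using assms
proof (induction arbitrary: e rule: disk_induct)
  case (limit f x)
  obtain k where k: "norm (f k - x) < e / 2"
    using LIMSEQ_D[OF limit.hyps(3), of "e / 2"] limit.prems by auto
  obtain N where N: "\<And>\<mu>. set \<mu> \<subseteq> {1..n} \<Longrightarrow> N \<le> length \<mu> \<Longrightarrow> \<exists>b\<in>disk. norm (adj (f k) * W \<mu> - b) < e / 2"
    using limit.IH[of "e / 2" k] limit.prems by auto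
  show ?case
  proof (intro exI[of _ N] allI impI, elim conjE)
    fix \<mu> assume \<mu>: "set \<mu> \<subseteq> {1..n}" "N \<le> length \<mu>"
    then obtain b where b: "b \<in> disk" "norm (adj (f k) * W \<mu> - b) < e / 2" using N by blast
    have "adj x * W \<mu> - b = (adj (f k) * W \<mu> - b) - adj (f k - x) * W \<mu>"
      by (simp add: adj_diff algebra_simps)
    also have "norm \<dots> \<le> norm (adj (f k) * W \<mu> - b) + norm (adj (f k - x) * W \<mu>)"
      by (rule norm_triangle_ineq4)
    also have "\<dots> < e / 2 + e / 2"
      using b(2) k norm_mult_ineq[of "adj (f k - x)" "W \<mu>"] norm_W[OF \<mu>(1)]
      by (intro add_strict_mono) auto
    finally show "\<exists>b\<in>disk. norm (adj x * W \<mu> - b) < e" using b(1) by auto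
  qed
next
  case (add x y)
  obtain N1 where N1: "\<And>\<mu>. set \<mu> \<subseteq> {1..n} \<Longrightarrow> N1 \<le> length \<mu> \<Longrightarrow> \<exists>b\<in>disk. norm (adj x * W \<mu> - b) < e / 2"
    using add.IH(1)[of "e / 2"] add.prems by auto
  obtain N2 where N2: "\<And>\<mu>. set \<mu> \<subseteq> {1..n} \<Longrightarrow> N2 \<le> length \<mu> \<Longrightarrow> \<exists>b\<in>disk. norm (adj y * W \<mu> - b) < e / 2"
    using add.IH(2)[of "e / 2"] add.prems by auto
  show ?case
  proof (intro exI[of _ "max N1 N2"] allI impI, elim conjE)
    fix \<mu> assume \<mu>: "set \<mu> \<subseteq> {1..n}" "max N1 N2 \<le> length \<mu>"
    obtain b c where b: "b \<in> disk" "norm (adj x * W \<mu> - b) < e / 2"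
      and c: "c \<in> disk" "norm (adj y * W \<mu> - c) < e / 2"
      using N1[of \<mu>] N2[of \<mu>] \<mu> by auto
    have "adj (x + y) * W \<mu> - (b + c) = (adj x * W \<mu> - b) + (adj y * W \<mu> - c)"
      by (simp add: adj_add algebra_simps)
    also have "norm \<dots> < e / 2 + e / 2"
      using b(2) c(2) by (intro norm_triangle_lt) simp
    finally show "\<exists>b\<in>disk. norm (adj (x + y) * W \<mu> - b) < e"
      using disk_add[OF b(1) c(1)] by auto
  qed
next
  case (word c \<nu>)
  have "adj (cs c (W \<nu>)) * W \<mu> \<in> disk" if "set \<mu> \<subseteq> {1..n}" "length \<nu> \<le> length \<mu>" for \<mu>
    using that word.hyps adj_W_mult_W[of \<nu> \<mu>]
    by (auto simp: adj_cs disk_0 intro!: disk_cs W_in_disk dest: in_set_dropD)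
  thus ?case using word.prems by (intro exI[of _ "length \<nu>"]) force
qed

section \<open>The right ideal generated by the images of the generators\<close>

context
  fixes \<alpha> :: "'a \<Rightarrow> 'a"
  assumes endo: "unital_star_endo cs adj \<alpha>" and disk_image: "\<alpha> ` disk \<subseteq> disk"
begin

definition t :: "nat \<Rightarrow> 'a" where "t i = \<alpha> (s i)"

definition \<tau> :: "nat \<Rightarrow> nat list \<Rightarrow> complex" where "\<tau> i \<mu> = ip (W \<mu>) (t i)"

definition coefficient_mass :: "nat list \<Rightarrow> real" where "coefficient_mass \<mu> = (\<Sum>i=1..n. (cmod (\<tau> i \<mu>))\<^sup>2)"

text \<open>\<open>backward i \<mu>\<close> is the analytic part of \<open>adj (t i) * W \<mu>\<close>, so that \<open>residual \<mu>\<close> is the component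
  of \<open>W \<mu>\<close> orthogonal to the right ideal generated by the \<open>t i\<close>.\<close>

definition backward :: "nat \<Rightarrow> nat list \<Rightarrow> 'a" where
  "backward i \<mu> = (\<Sum>k\<le>length \<mu>. cs (cnj (\<tau> i (take k \<mu>))) (W (drop k \<mu>)))"

definition residual :: "nat list \<Rightarrow> 'a" where
  "residual \<mu> = W \<mu> - (\<Sum>i=1..n. t i * backward i \<mu>)"

lemma t_in_disk: "i \<in> {1..n} \<Longrightarrow> t i \<in> disk"
  using disk_image s_in_disk by (auto simp: t_def)

lemma adj_t_mult_t: "i \<in> {1..n} \<Longrightarrow> j \<in> {1..n} \<Longrightarrow> adj (t i) * t j = (if i = j then 1 else 0)"
  using adj_s_mult_s[of i j]
  by (simp add: t_def endo_1[OF endo] endo_0[OF endo]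
      flip: endo_mult[OF endo] endo_adj[OF endo] split: if_splits)

lemma norm_t: "i \<in> {1..n} \<Longrightarrow> norm (t i) = 1"
  using adj_t_mult_t[of i i] norm_isometry by simp

lemma sum_t_adj_t: "(\<Sum>i=1..n. t i * adj (t i)) = 1"
proof -
  have "(\<Sum>i\<in>I. t i * adj (t i)) = \<alpha> (\<Sum>i\<in>I. s i * adj (s i))" for I
    by (induction I rule: infinite_finite_induct)
       (simp_all add: t_def endo_0[OF endo] endo_add[OF endo] endo_mult[OF endo] endo_adj[OF endo])
  thus ?thesis by (simp add: sum_range_projections endo_1[OF endo])
qed

lemma drop_in_words: "set \<mu> \<subseteq> {1..n} \<Longrightarrow> set (drop k \<mu>) \<subseteq> {1..n}"
  using set_drop_subset by (rule subset_trans)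

lemma backward_in_disk: "set \<mu> \<subseteq> {1..n} \<Longrightarrow> backward i \<mu> \<in> disk"
  unfolding backward_def by (intro disk_sum disk_cs W_in_disk drop_in_words)

lemma residual_in_disk: "set \<mu> \<subseteq> {1..n} \<Longrightarrow> residual \<mu> \<in> disk"
  unfolding residual_def by (intro disk_diff disk_sum disk_mult W_in_disk backward_in_disk t_in_disk)

text \<open>For a word \<open>W \<rho>\<close> in place of \<open>b\<close>, both sides single out
  the cut of \<open>\<mu>\<close> that leaves \<open>\<rho>\<close> as second half. In Fock terms,
  \<open>backward i \<mu>\<close> is the adjoint of left multiplication by \<open>t i\<close>,
  applied to \<open>W \<mu>\<close>.\<close>

lemma ip_t_mult_W:
  assumes b: "b \<in> disk" and \<mu>: "set \<mu> \<subseteq> {1..n}" and i: "i \<in> {1..n}"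
  shows "ip (t i * b) (W \<mu>) = ip b (backward i \<mu>)"
  using b
proof (induction rule: disk_induct)
  case (limit f x)
  have "(\<lambda>k. ip (t i * f k) (W \<mu>)) \<longlonglongrightarrow> ip (t i * x) (W \<mu>)"
    using limit by (intro ip_tendsto tendsto_intros disk_mult t_in_disk i W_in_disk \<mu>) auto
  moreover have "(\<lambda>k. ip (f k) (backward i \<mu>)) \<longlonglongrightarrow> ip x (backward i \<mu>)"
    using limit by (intro ip_tendsto tendsto_intros backward_in_disk \<mu>) auto
  ultimately show ?case unfolding limit.IH by (rule LIMSEQ_unique)
next
  case (add x y)
  thus ?case
    using i \<mu> by (simp add: ring_distribs ip_add_left disk_mult t_in_disk W_in_disk backward_in_disk del: atLeastAtMost_iff)
next
  case (word c \<rho>)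
  define l where "l = length \<mu> - length \<rho>"
  have "ip (t i * W \<rho>) (W \<mu>) = cnj (ip (W \<mu>) (t i * W \<rho>))"
    using i word \<mu> by (intro ip_commute disk_mult W_in_disk t_in_disk)
  also have "\<dots> = (if drop l \<mu> = \<rho> then cnj (\<tau> i (take l \<mu>)) else 0)"
    using ip_W_mult_W[OF t_in_disk[OF i] \<mu> word] by (simp add: \<tau>_def l_def)
  also have "\<dots> = (\<Sum>k\<le>length \<mu>. if k = l then (if drop l \<mu> = \<rho> then cnj (\<tau> i (take l \<mu>)) else 0) else 0)"
    by (simp add: l_def)
  also have "\<dots> = (\<Sum>k\<le>length \<mu>. cnj (\<tau> i (take k \<mu>)) * ip (W \<rho>) (W (drop k \<mu>)))"
    by (intro sum.cong refl) (use word \<mu> drop_in_words[OF \<mu>] in \<open>auto simp: ip_W_W l_def\<close>)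
  also have "\<dots> = ip (W \<rho>) (backward i \<mu>)"
    unfolding backward_def using word drop_in_words[OF \<mu>]
    by (simp add: ip_sum_right ip_cs_right W_in_disk disk_cs)
  finally show ?case
    using word i \<mu> by (simp add: ip_cs_left disk_mult t_in_disk W_in_disk backward_in_disk del: atLeastAtMost_iff)
qed

lemma ip_t_mult_residual:
  assumes b: "b \<in> disk" and \<mu>: "set \<mu> \<subseteq> {1..n}" and i: "i \<in> {1..n}"
  shows "ip (t i * b) (residual \<mu>) = 0"
proof -
  have "ip (t i * b) (\<Sum>j=1..n. t j * backward j \<mu>) = (\<Sum>j=1..n. ip (t i * b) (t j * backward j \<mu>))"
    by (intro ip_sum_right disk_mult t_in_disk backward_in_disk b \<mu> i)
  also have "\<dots> = (\<Sum>j=1..n. if j = i then ip b (backward i \<mu>) else 0)"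
  proof (intro sum.cong refl)
    fix j assume "j \<in> {1..n}"
    thus "ip (t i * b) (t j * backward j \<mu>) = (if j = i then ip b (backward i \<mu>) else 0)"
      using adj_t_mult_t[of i j] i b \<mu> t_in_disk
      by (cases "j = i") (simp_all add: ip_mult_isometry ip_mult_orthogonal backward_in_disk del: atLeastAtMost_iff)
  qed
  also have "\<dots> = ip b (backward i \<mu>)" using i by simp
  finally have "ip (t i * b) (\<Sum>j=1..n. t j * backward j \<mu>) = ip b (backward i \<mu>)" .
  moreover have "ip (t i * b) (residual \<mu>) = ip (t i * b) (W \<mu>) - ip (t i * b) (\<Sum>j=1..n. t j * backward j \<mu>)"
    unfolding residual_def by (intro ip_diff_right disk_sum disk_mult t_in_disk backward_in_disk W_in_disk b \<mu> i)
  ultimately show ?thesis using ip_t_mult_W[OF b \<mu> i] by simp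
qed

lemma ip_ideal_residual:
  assumes b: "\<And>i. i \<in> {1..n} \<Longrightarrow> b i \<in> disk" and \<mu>: "set \<mu> \<subseteq> {1..n}"
  shows "ip (\<Sum>i=1..n. t i * b i) (residual \<mu>) = 0"
proof -
  have "ip (\<Sum>i=1..n. t i * b i) (residual \<mu>) = (\<Sum>i=1..n. ip (t i * b i) (residual \<mu>))"
    by (intro ip_sum_left disk_mult t_in_disk residual_in_disk b \<mu>)
  thus ?thesis using ip_t_mult_residual[OF b \<mu>] by simp
qed

text \<open>The part of \<open>residual \<nu>\<close> inside the ideal is orthogonal to
  \<open>residual \<mu>\<close>. So the Fourier coefficients of a residual are the Gram matrix
  entries of the residuals.\<close>

lemma ip_residual_residual:
  assumes "set \<mu> \<subseteq> {1..n}" "set \<nu> \<subseteq> {1..n}"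
  shows "ip (residual \<nu>) (residual \<mu>) = ip (W \<nu>) (residual \<mu>)"
proof -
  have "ip (residual \<nu>) (residual \<mu>) = ip (W \<nu>) (residual \<mu>) - ip (\<Sum>i=1..n. t i * backward i \<nu>) (residual \<mu>)"
    unfolding residual_def[of \<nu>]
    by (intro ip_diff_left disk_sum disk_mult t_in_disk backward_in_disk W_in_disk residual_in_disk assms)
  thus ?thesis using ip_ideal_residual[OF backward_in_disk[OF assms(2)] assms(1)] by simp
qed

text \<open>\<open>W \<mu>\<close> meets \<open>t i * W (drop k \<mu>)\<close> in the coefficient of
  \<open>t i\<close> at \<open>take k \<mu>\<close>, so only prefixes of \<open>\<mu>\<close> enter.
  Appending a letter thus removes a single further term, the source of the recursion for the
  trace.\<close>

lemma nrm2_residual: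
  assumes \<mu>: "set \<mu> \<subseteq> {1..n}"
  shows "nrm2 (residual \<mu>) = 1 - (\<Sum>k\<le>length \<mu>. coefficient_mass (take k \<mu>))"
proof -
  have 1: "ip (W \<mu>) (t i * backward i \<mu>) = (\<Sum>k\<le>length \<mu>. complex_of_real ((cmod (\<tau> i (take k \<mu>)))\<^sup>2))"
    if i: "i \<in> {1..n}" for i
  proof -
    have "t i * backward i \<mu> = (\<Sum>k\<le>length \<mu>. cs (cnj (\<tau> i (take k \<mu>))) (t i * W (drop k \<mu>)))"
      by (simp add: backward_def sum_distrib_left)
    hence "ip (W \<mu>) (t i * backward i \<mu>)
        = (\<Sum>k\<le>length \<mu>. ip (W \<mu>) (cs (cnj (\<tau> i (take k \<mu>))) (t i * W (drop k \<mu>))))"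
      using ip_sum_right[of "W \<mu>" "{..length \<mu>}" "\<lambda>k. cs (cnj (\<tau> i (take k \<mu>))) (t i * W (drop k \<mu>))"]
        disk_cs disk_mult t_in_disk[OF i] W_in_disk[OF \<mu>] W_in_disk[OF drop_in_words[OF \<mu>]] by simp
    also have "\<dots> = (\<Sum>k\<le>length \<mu>. complex_of_real ((cmod (\<tau> i (take k \<mu>)))\<^sup>2))"
    proof (intro sum.cong refl)
      fix k assume "k \<in> {..length \<mu>}"
      hence "ip (W \<mu>) (t i * W (drop k \<mu>)) = \<tau> i (take k \<mu>)"
        using ip_W_mult_W[OF t_in_disk[OF i] \<mu> drop_in_words[OF \<mu>, of k]] by (simp add: \<tau>_def)
      moreover have "ip (W \<mu>) (cs (cnj (\<tau> i (take k \<mu>))) (t i * W (drop k \<mu>)))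
          = cnj (\<tau> i (take k \<mu>)) * ip (W \<mu>) (t i * W (drop k \<mu>))"
        by (intro ip_cs_right disk_mult t_in_disk W_in_disk drop_in_words \<mu> i)
      ultimately show "ip (W \<mu>) (cs (cnj (\<tau> i (take k \<mu>))) (t i * W (drop k \<mu>)))
          = complex_of_real ((cmod (\<tau> i (take k \<mu>)))\<^sup>2)"
        by (simp add: complex_norm_square mult.commute del: of_real_power)
    qed
    finally show ?thesis .
  qed
  have "ip (residual \<mu>) (residual \<mu>) = ip (W \<mu>) (residual \<mu>)" by (rule ip_residual_residual[OF \<mu> \<mu>])
  also have "\<dots> = ip (W \<mu>) (W \<mu>) - ip (W \<mu>) (\<Sum>i=1..n. t i * backward i \<mu>)"
    unfolding residual_def by (intro ip_diff_right disk_sum disk_mult t_in_disk backward_in_disk W_in_disk \<mu>)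
  also have "ip (W \<mu>) (\<Sum>i=1..n. t i * backward i \<mu>) = (\<Sum>i=1..n. ip (W \<mu>) (t i * backward i \<mu>))"
    by (intro ip_sum_right disk_mult t_in_disk backward_in_disk W_in_disk \<mu>)
  also have "\<dots> = (\<Sum>i=1..n. \<Sum>k\<le>length \<mu>. complex_of_real ((cmod (\<tau> i (take k \<mu>)))\<^sup>2))"
    by (intro sum.cong refl 1)
  also have "\<dots> = complex_of_real (\<Sum>k\<le>length \<mu>. coefficient_mass (take k \<mu>))"
    unfolding coefficient_mass_def of_real_sum by (rule sum.swap)
  finally show ?thesis using \<mu> by (simp add: nrm2_def ip_W_W)
qed

lemma nrm2_add_orthogonal:
  assumes "a \<in> disk" "b \<in> disk" "ip b a = 0"
  shows "nrm2 (a + b) = nrm2 a + nrm2 b"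
  using assms ip_commute[of b a] by (simp add: nrm2_def ip_add_left ip_add_right disk_add)

text \<open>Here the identity \<open>\<Sum>i. t i * adj (t i) = 1\<close> enters: \<open>W \<mu>\<close> almost lies in the right ideal
  generated by the \<open>t i\<close>, because \<open>adj (t i) * W \<mu>\<close> is almost analytic.\<close>

lemma nrm2_residual_small:
  assumes "e > 0"
  shows "\<exists>N. \<forall>\<mu>. set \<mu> \<subseteq> {1..n} \<and> N \<le> length \<mu> \<longrightarrow> nrm2 (residual \<mu>) \<le> e"
proof -
  define d where "d = sqrt e / real n"
  have n0: "real n > 0" using n_ge_2 by simp
  hence d: "d > 0" using assms by (simp add: d_def)
  have "\<exists>N. \<forall>i\<in>{1..n}. \<forall>\<mu>. set \<mu> \<subseteq> {1..n} \<and> N \<le> length \<mu> \<longrightarrow> (\<exists>b\<in>disk. norm (adj (t i) * W \<mu> - b) < d)"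
  proof -
    have "\<forall>i\<in>{1..n}. \<exists>N. \<forall>\<mu>. set \<mu> \<subseteq> {1..n} \<and> N \<le> length \<mu> \<longrightarrow> (\<exists>b\<in>disk. norm (adj (t i) * W \<mu> - b) < d)"
      using adj_mult_W_approx[OF t_in_disk d] by blast
    then obtain K where K: "\<And>i \<mu>. i \<in> {1..n} \<Longrightarrow> set \<mu> \<subseteq> {1..n} \<Longrightarrow> K i \<le> length \<mu> \<Longrightarrow>
        \<exists>b\<in>disk. norm (adj (t i) * W \<mu> - b) < d" by metis
    have "K i \<le> sum K {1..n}" if "i \<in> {1..n}" for i
      using that by (intro member_le_sum) auto
    thus ?thesis using K by (intro exI[of _ "sum K {1..n}"]) (meson order_trans)
  qed
  then obtain N where N: "\<And>i \<mu>. i \<in> {1..n} \<Longrightarrow> set \<mu> \<subseteq> {1..n} \<Longrightarrow> N \<le> length \<mu> \<Longrightarrow>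
      \<exists>b\<in>disk. norm (adj (t i) * W \<mu> - b) < d" by blast
  have "nrm2 (residual \<mu>) \<le> e" if \<mu>: "set \<mu> \<subseteq> {1..n}" "N \<le> length \<mu>" for \<mu>
  proof -
    from N[OF _ \<mu>] obtain b where b: "\<And>i. i \<in> {1..n} \<Longrightarrow> b i \<in> disk"
      "\<And>i. i \<in> {1..n} \<Longrightarrow> norm (adj (t i) * W \<mu> - b i) < d" by metis
    \<comment> \<open>An element of the ideal, orthogonal to the residual, so adding it can only
      raise \<open>nrm2\<close>. It trades \<open>backward i \<mu>\<close> for \<open>b i\<close>,
      after which the sum consists of \<open>n\<close> terms of norm at most
      \<open>d\<close>.\<close>
    define k where "k = (\<Sum>i=1..n. t i * (backward i \<mu> - b i))"
    have k: "k \<in> disk" unfolding k_def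
      by (intro disk_sum disk_mult disk_diff t_in_disk backward_in_disk b \<mu>)
    have "ip k (residual \<mu>) = 0"
      unfolding k_def by (intro ip_ideal_residual disk_diff backward_in_disk b \<mu>)
    hence "nrm2 (residual \<mu>) \<le> nrm2 (residual \<mu> + k)"
      using nrm2_add_orthogonal[OF residual_in_disk[OF \<mu>(1)] k] nrm2_nonneg[OF k] by simp
    also have "\<dots> \<le> (norm (residual \<mu> + k))\<^sup>2"
      by (intro nrm2_le disk_add residual_in_disk k \<mu>)
    finally have le: "nrm2 (residual \<mu>) \<le> (norm (residual \<mu> + k))\<^sup>2" .
    have "residual \<mu> + k = (\<Sum>i=1..n. t i * (adj (t i) * W \<mu> - b i))"
    proof -
      have "W \<mu> = (\<Sum>i=1..n. t i * adj (t i)) * W \<mu>" by (simp only: sum_t_adj_t mult_1_left)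
      also have "\<dots> = (\<Sum>i=1..n. t i * (adj (t i) * W \<mu>))"
        by (simp add: sum_distrib_right mult.assoc)
      finally have "W \<mu> = (\<Sum>i=1..n. t i * (adj (t i) * W \<mu>))" .
      thus ?thesis by (simp add: residual_def k_def right_diff_distrib sum_subtractf)
    qed
    also have "norm \<dots> \<le> real (card {1..n}) * d"
    proof (rule sum_norm_bound)
      fix i assume i: "i \<in> {1..n}"
      have "norm (t i * (adj (t i) * W \<mu> - b i)) \<le> norm (t i) * norm (adj (t i) * W \<mu> - b i)"
        by (rule norm_mult_ineq)
      thus "norm (t i * (adj (t i) * W \<mu> - b i)) \<le> d"
        using norm_t[OF i] b(2)[OF i] by simp
    qed
    also have "real (card {1..n}) * d = sqrt e" using n0 by (simp add: d_def)
    finally have "(norm (residual \<mu> + k))\<^sup>2 \<le> (sqrt e)\<^sup>2" by (intro power_mono) simp_all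
    with le show ?thesis using assms by simp
  qed
  thus ?thesis by blast
qed

section \<open>The dimension count for the cokernel\<close>

definition cokernel_trace :: "nat \<Rightarrow> real" where
  "cokernel_trace m = (\<Sum>\<mu>\<in>wds m. nrm2 (residual \<mu>))"

text \<open>Each \<open>t i\<close> is an isometry, so its coefficients have total mass 1 and all of
  them together mass \<open>n\<close>. A word has \<open>n\<close> extensions by one letter, each
  losing its own \<open>coefficient_mass\<close>. Positivity in degree 0 is used twice later:
  \<open>residual []\<close> can serve as spanning vector, and \<open>\<theta>\<close> has norm
  below 1.\<close>

lemma cokernel_trace_sums: "cokernel_trace sums 1" "cokernel_trace 0 > 0"
proof -
  define f where "f m = (\<Sum>i=1..n. energy (t i) m)" for m
  have fF: "f m = (\<Sum>\<mu>\<in>wds m. coefficient_mass \<mu>)" for m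
    unfolding f_def energy_def coefficient_mass_def \<tau>_def by (rule sum.swap)
  have "nrm2 (t i) = 1" if i: "i \<in> {1..n}" for i
    using ip_mult_isometry[of "t i" 1 1] adj_t_mult_t[OF i i] ip_W_W[of "[]" "[]"]
    by (simp add: nrm2_def)
  hence "energy (t i) sums 1" if "i \<in> {1..n}" for i
    using parseval[OF t_in_disk[OF that]] that by simp
  hence "f sums (\<Sum>i=1..n. 1)" unfolding f_def by (intro sums_sum) auto
  hence f: "f sums real n" by simp
  have f0: "f m \<ge> 0" for m unfolding f_def by (intro sum_nonneg energy_nonneg)
  have S0: "cokernel_trace m \<ge> 0" for m
    unfolding cokernel_trace_def by (intro sum_nonneg nrm2_nonneg residual_in_disk wdsD)
  have S_0: "cokernel_trace 0 = 1 - f 0" by (simp add: cokernel_trace_def fF nrm2_residual)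
  have S_Suc: "cokernel_trace (Suc m) = real n * cokernel_trace m - f (Suc m)" for m
  proof -
    have "nrm2 (residual (\<mu> @ [j])) = nrm2 (residual \<mu>) - coefficient_mass (\<mu> @ [j])" if "set \<mu> \<subseteq> {1..n}" "j \<in> {1..n}" for \<mu> j
    proof -
      have "(\<Sum>k\<le>length (\<mu> @ [j]). coefficient_mass (take k (\<mu> @ [j]))) = (\<Sum>k\<le>length \<mu>. coefficient_mass (take k \<mu>)) + coefficient_mass (\<mu> @ [j])"
        by simp
      thus ?thesis using nrm2_residual[of \<mu>] nrm2_residual[of "\<mu> @ [j]"] that by simp
    qed
    hence "cokernel_trace (Suc m) = (\<Sum>\<mu>\<in>wds m. \<Sum>j=1..n. nrm2 (residual \<mu>) - coefficient_mass (\<mu> @ [j]))"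
      unfolding cokernel_trace_def sum_wds_Suc' by (intro sum.cong refl) (auto dest: wdsD)
    thus ?thesis
      unfolding fF sum_wds_Suc' by (simp add: sum_subtractf cokernel_trace_def sum_distrib_left)
  qed
  have lim: "(\<lambda>m. cokernel_trace m / real n ^ m) \<longlonglongrightarrow> 0"
  proof (rule LIMSEQ_I)
    fix r :: real assume "r > 0"
    then obtain N where N: "\<And>\<mu>. set \<mu> \<subseteq> {1..n} \<Longrightarrow> N \<le> length \<mu> \<Longrightarrow> nrm2 (residual \<mu>) \<le> r / 2"
      using nrm2_residual_small[of "r / 2"] by auto
    have "norm (cokernel_trace m / real n ^ m - 0) < r" if "m \<ge> N" for m
    proof -
      have "cokernel_trace m \<le> real (card (wds m)) * (r / 2)"
        unfolding cokernel_trace_def by (intro sum_bounded_above N) (use that in \<open>auto simp: wds_def\<close>)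
      also have "\<dots> = real n ^ m * (r / 2)" by (simp add: card_wds)
      finally have "cokernel_trace m / real n ^ m \<le> r / 2"
        using n_ge_2 by (simp add: divide_le_eq mult.commute)
      moreover have "cokernel_trace m / real n ^ m \<ge> 0" using S0 by simp
      ultimately show ?thesis
        unfolding diff_zero real_norm_def using \<open>r > 0\<close> by linarith
    qed
    thus "\<exists>N. \<forall>m\<ge>N. norm (cokernel_trace m / real n ^ m - 0) < r" by blast
  qed
  have "real n > 1" using n_ge_2 by simp
  from cokernel_mass[OF this f0 f S0 S_0 S_Suc lim] show "cokernel_trace sums 1" "cokernel_trace 0 > 0" by auto
qed

text \<open>Equality in the summed Cauchy-Schwarz inequality: the cokernel is spanned by \<open>residual []\<close>.\<close>

lemma residual_proportional:
  assumes \<mu>: "set \<mu> \<subseteq> {1..n}"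
  shows "\<exists>c. residual \<mu> = cs c (residual [])"
proof -
  define g where "g = nrm2 (residual [])"
  have g: "g > 0" using cokernel_trace_sums(2) by (simp add: cokernel_trace_def g_def)
  have e: "residual [] \<in> disk" by (simp add: residual_in_disk)
  define c where "c \<mu> = ip (residual \<mu>) (residual [])" for \<mu>
  \<comment> \<open>The squared distance from \<open>residual \<mu>\<close> to the line through
    \<open>residual []\<close>; the scalar is the coefficient of the orthogonal projection onto that
    line.\<close>
  define D where "D \<mu> = nrm2 (residual \<mu> - cs (cnj (c \<mu>) / g) (residual []))" for \<mu>
  have D: "D \<mu> = nrm2 (residual \<mu>) - (cmod (c \<mu>))\<^sup>2 / g" "D \<mu> \<ge> 0" if "set \<mu> \<subseteq> {1..n}" for \<mu>
  proof -
    have hm: "residual \<mu> \<in> disk" using that by (rule residual_in_disk)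
    show "D \<mu> \<ge> 0" unfolding D_def by (intro nrm2_nonneg disk_diff disk_cs hm e)
    define l where "l = cnj (c \<mu>) / complex_of_real g"
    have "ip (residual \<mu> - cs l (residual [])) (residual \<mu> - cs l (residual []))
        = ip (residual \<mu>) (residual \<mu>) - cnj l * ip (residual []) (residual \<mu>) - (l * ip (residual \<mu>) (residual []) - l * (cnj l * ip (residual []) (residual [])))"
      using hm e by (simp add: ip_diff_left ip_diff_right ip_cs_left ip_cs_right disk_diff disk_cs algebra_simps)
    also have "ip (residual []) (residual \<mu>) = cnj (c \<mu>)" unfolding c_def by (rule ip_commute[OF hm e])
    also have "ip (residual \<mu>) (residual []) = c \<mu>" by (simp add: c_def)
    also have "ip (residual []) (residual []) = complex_of_real g" unfolding g_def by (rule ip_self[OF e])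
    also have "ip (residual \<mu>) (residual \<mu>) - cnj l * cnj (c \<mu>) - (l * c \<mu> - l * (cnj l * complex_of_real g))
        = ip (residual \<mu>) (residual \<mu>) - c \<mu> * cnj (c \<mu>) / g"
      using g by (simp add: l_def field_simps)
    also have "c \<mu> * cnj (c \<mu>) / g = complex_of_real ((cmod (c \<mu>))\<^sup>2 / g)"
      by (simp add: complex_norm_square[symmetric])
    finally show "D \<mu> = nrm2 (residual \<mu>) - (cmod (c \<mu>))\<^sup>2 / g"
      by (simp add: D_def nrm2_def l_def)
  qed
  \<comment> \<open>The coefficients of \<open>residual []\<close> are the \<open>c \<mu>\<close>,
    up to conjugation. Hence the distances sum to \<open>1 - g / g = 0\<close>, and being
    nonnegative they all vanish.\<close>
  have "energy (residual []) sums g" unfolding g_def by (rule parseval[OF e])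
  hence "(\<lambda>m. cokernel_trace m - energy (residual []) m / g) sums (1 - g / g)"
    by (intro sums_diff sums_divide cokernel_trace_sums)
  moreover have "cokernel_trace m - energy (residual []) m / g = (\<Sum>\<mu>\<in>wds m. D \<mu>)" for m
  proof -
    have "energy (residual []) m = (\<Sum>\<mu>\<in>wds m. (cmod (c \<mu>))\<^sup>2)"
      unfolding energy_def c_def by (intro sum.cong refl) (simp add: ip_residual_residual wdsD)
    moreover have "(\<Sum>\<mu>\<in>wds m. D \<mu>) = (\<Sum>\<mu>\<in>wds m. nrm2 (residual \<mu>) - (cmod (c \<mu>))\<^sup>2 / g)"
      by (intro sum.cong refl D wdsD)
    ultimately show ?thesis by (simp add: cokernel_trace_def sum_subtractf sum_divide_distrib)
  qed
  ultimately have sums: "(\<lambda>m. \<Sum>\<mu>\<in>wds m. D \<mu>) sums 0" using g by simp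
  have nn: "(\<Sum>\<mu>\<in>wds m. D \<mu>) \<ge> 0" for m by (intro sum_nonneg D wdsD)
  have "(\<Sum>\<mu>\<in>wds m. D \<mu>) = 0" for m
    using suminf_eq_zero_iff[OF sums_summable[OF sums] nn] sums_unique[OF sums] by simp
  hence "(\<Sum>\<nu>\<in>wds (length \<mu>). D \<nu>) = 0" .
  moreover have "\<mu> \<in> wds (length \<mu>)" using \<mu> by (simp add: wds_def)
  moreover have "\<And>\<nu>. \<nu> \<in> wds (length \<mu>) \<Longrightarrow> D \<nu> \<ge> 0" by (intro D wdsD)
  ultimately have "D \<mu> = 0" by (metis finite_wds sum_nonneg_eq_0_iff)
  hence "residual \<mu> - cs (cnj (c \<mu>) / g) (residual []) = 0"
    unfolding D_def by (intro nrm2_eq_0_imp disk_diff disk_cs residual_in_disk \<mu> e)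
  thus ?thesis by auto
qed

section \<open>Surjectivity\<close>

lemma closed_endo_image:
  assumes "closed C"
  shows "closed (\<alpha> ` C)"
  unfolding closed_sequential_limits
proof (intro allI impI, elim conjE)
  fix f l assume f: "\<forall>k. f k \<in> \<alpha> ` C" "f \<longlonglongrightarrow> l"
  hence "\<forall>k. \<exists>x. x \<in> C \<and> f k = \<alpha> x" by blast
  then obtain a where a: "\<And>k. a k \<in> C" "\<And>k. f k = \<alpha> (a k)" by metis
  have dist: "dist (\<alpha> x) (\<alpha> y) = dist x y" for x y
    using endo_isometric[OF endo, of "x - y"] by (simp add: dist_norm endo_diff[OF endo])
  have "Cauchy a"
    using LIMSEQ_imp_Cauchy[OF f(2)] unfolding Cauchy_def a(2) dist .
  then obtain x where x: "a \<longlonglongrightarrow> x" using Cauchy_convergent_iff convergent_def by blast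
  hence "x \<in> C" using a(1) assms closed_sequentially by blast
  moreover have "f \<longlonglongrightarrow> \<alpha> x"
    using x unfolding tendsto_iff a(2) dist .
  ultimately show "l \<in> \<alpha> ` C" using LIMSEQ_unique[OF f(2)] by blast
qed

lemma one_in_image: "1 \<in> \<alpha> ` disk"
  using imageI[OF one_in_disk, of \<alpha>] by (simp add: endo_1[OF endo])

lemma add_in_image: "x \<in> \<alpha> ` disk \<Longrightarrow> y \<in> \<alpha> ` disk \<Longrightarrow> x + y \<in> \<alpha> ` disk"
  by (elim imageE, simp only: endo_add[OF endo, symmetric]) (intro imageI disk_add)

lemma mult_in_image: "x \<in> \<alpha> ` disk \<Longrightarrow> y \<in> \<alpha> ` disk \<Longrightarrow> x * y \<in> \<alpha> ` disk"
  by (elim imageE, simp only: endo_mult[OF endo, symmetric]) (intro imageI disk_mult)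

lemma cs_in_image: "x \<in> \<alpha> ` disk \<Longrightarrow> cs c x \<in> \<alpha> ` disk"
  by (elim imageE, simp only: endo_cs[OF endo, symmetric]) (intro imageI disk_cs)

lemma sum_in_image: "finite I \<Longrightarrow> (\<And>i. i \<in> I \<Longrightarrow> f i \<in> \<alpha> ` disk) \<Longrightarrow> sum f I \<in> \<alpha> ` disk"
proof (induction I rule: finite_induct)
  case empty
  show ?case using cs_in_image[OF one_in_image, of 0] by simp
qed (auto intro: add_in_image simp del: image_iff)

lemma s_in_image:
  assumes j: "j \<in> {1..n}"
  shows "s j \<in> \<alpha> ` disk"
proof -
  define \<theta> where "\<theta> = (\<Sum>i=1..n. cs (cnj (\<tau> i [])) (t i))"
  define y where "y = (\<Sum>i=1..n. cs (cnj (\<tau> i [j])) (t i))"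
  have ti: "t i \<in> \<alpha> ` disk" if "i \<in> {1..n}" for i
    using s_in_disk[OF that] by (simp add: t_def)
  have im: "\<theta> \<in> \<alpha> ` disk" "y \<in> \<alpha> ` disk"
    unfolding \<theta>_def y_def by (auto intro!: sum_in_image cs_in_image ti simp del: image_iff)
  have h0: "residual [] = 1 - \<theta>" by (simp add: residual_def backward_def \<theta>_def)
  have hj: "residual [j] = s j - \<theta> * s j - y"
  proof -
    have "backward i [j] = cs (cnj (\<tau> i [])) (s j) + cs (cnj (\<tau> i [j])) 1" for i
      by (simp add: backward_def W_Cons)
    thus ?thesis
      by (simp add: residual_def W_Cons \<theta>_def y_def ring_distribs sum.distrib sum_distrib_right)
  qed
  obtain l where l: "residual [j] = cs l (residual [])" using residual_proportional[of "[j]"] j by auto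
  have y: "(1 - \<theta>) * (s j - cs l 1) = y"
    using l unfolding h0 hj by (simp add: algebra_simps cs_diff)
  \<comment> \<open>By orthonormality of the \<open>t i\<close>,
    \<open>adj \<theta> * \<theta>\<close> is the scalar \<open>coefficient_mass []\<close>, and
    \<open>1 - coefficient_mass []\<close> is the trace in degree 0, which is positive.\<close>
  have "norm \<theta> < 1"
  proof -
    have "adj \<theta> * \<theta> = (\<Sum>i=1..n. \<Sum>k=1..n. cs (\<tau> i [] * cnj (\<tau> k [])) (adj (t i) * t k))"
      by (simp add: \<theta>_def adj_sum adj_cs sum_product cs_cs mult.commute)
    also have "\<dots> = (\<Sum>i=1..n. \<Sum>k=1..n. if i = k then cs (\<tau> i [] * cnj (\<tau> i [])) 1 else 0)"
      by (intro sum.cong refl) (simp add: adj_t_mult_t del: atLeastAtMost_iff)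
    also have "\<dots> = (\<Sum>i=1..n. cs (\<tau> i [] * cnj (\<tau> i [])) 1)"
      by (intro sum.cong refl) (simp add: sum.delta)
    also have "\<dots> = cs (complex_of_real (coefficient_mass [])) 1"
      by (simp add: coefficient_mass_def complex_norm_square cs_sum_left del: of_real_power)
    finally have "(norm \<theta>)\<^sup>2 = \<bar>coefficient_mass []\<bar>"
      using cstar_identity[of \<theta>] by (simp add: norm_cs)
    moreover have "coefficient_mass [] \<ge> 0" unfolding coefficient_mass_def by (intro sum_nonneg) simp
    moreover have "coefficient_mass [] < 1" using cokernel_trace_sums(2) nrm2_residual[of "[]"] by (simp add: cokernel_trace_def)
    ultimately have "(norm \<theta>)\<^sup>2 < 1\<^sup>2" by simp
    thus ?thesis by (rule power2_less_imp_less) simp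
  qed
  hence lim: "(\<lambda>N. (1 - \<theta> ^ N) * (s j - cs l 1)) \<longlonglongrightarrow> (1 - 0) * (s j - cs l 1)"
    by (intro tendsto_intros LIMSEQ_power_zero)
  \<comment> \<open>Partial sums of the Neumann series applied to \<open>y\<close> stay in the
    image, because \<open>\<theta>\<close> and \<open>y\<close> lie there; closedness of the image
    then supplies the limit.\<close>
  have partial: "(1 - \<theta> ^ N) * (s j - cs l 1) \<in> \<alpha> ` disk" for N
  proof -
    have "(\<Sum>k<N. \<theta> ^ k) * (1 - \<theta>) = 1 - \<theta> ^ N"
    proof (induction N)
      case (Suc N)
      have "(\<Sum>k<Suc N. \<theta> ^ k) * (1 - \<theta>) = (1 - \<theta> ^ N) + \<theta> ^ N * (1 - \<theta>)"
        using Suc by (simp add: distrib_right)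
      thus ?case by (simp add: right_diff_distrib power_commutes)
    qed simp
    hence "(1 - \<theta> ^ N) * (s j - cs l 1) = (\<Sum>k<N. \<theta> ^ k) * ((1 - \<theta>) * (s j - cs l 1))"
      by (simp only: mult.assoc[symmetric])
    hence "(1 - \<theta> ^ N) * (s j - cs l 1) = (\<Sum>k<N. \<theta> ^ k) * y" by (simp only: y)
    moreover have "\<theta> ^ k \<in> \<alpha> ` disk" for k
      by (induction k) (auto intro: one_in_image mult_in_image im simp del: image_iff)
    ultimately show ?thesis by (simp add: mult_in_image sum_in_image im del: image_iff)
  qed
  have "s j - cs l 1 \<in> \<alpha> ` disk"
    using closed_sequentially[OF closed_endo_image[OF closed_disk] partial lim] by simp
  from add_in_image[OF this cs_in_image[OF one_in_image, of l]] show ?thesis by simp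
qed

lemma image_eq_disk: "\<alpha> ` disk = disk"
proof (rule antisym[OF disk_image])
  show "disk \<subseteq> \<alpha> ` disk"
    by (intro disk_minimal closed_endo_image closed_disk s_in_image one_in_image
        add_in_image mult_in_image cs_in_image)
qed

lemma endo_bij: "bij \<alpha>"
proof (rule bijI)
  show "inj \<alpha>"
    using endo_isometric[OF endo] endo_diff[OF endo]
    by (intro injI) (metis eq_iff_diff_eq_0 norm_eq_zero)
  show "range \<alpha> = UNIV"
  proof (rule cstar_gen_eq_UNIV)
    show "s i \<in> range \<alpha>" if "i \<in> {1..n}" for i using s_in_image[OF that] by blast
    show "1 \<in> range \<alpha>" using endo_1[OF endo] by (metis rangeI)
    show "closed (range \<alpha>)" by (rule closed_endo_image) simp
    fix x y assume "x \<in> range \<alpha>" "y \<in> range \<alpha>"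
    then obtain a b where ab: "x = \<alpha> a" "y = \<alpha> b" by blast
    show "x + y \<in> range \<alpha>" unfolding ab endo_add[OF endo, symmetric] by simp
    show "x * y \<in> range \<alpha>" unfolding ab endo_mult[OF endo, symmetric] by simp
    show "cs c x \<in> range \<alpha>" for c unfolding ab endo_cs[OF endo, symmetric] by simp
    show "adj x \<in> range \<alpha>" unfolding ab endo_adj[OF endo, symmetric] by simp
  qed
qed

end

end

theorem theoremT:
  fixes cs :: "complex \<Rightarrow> 'a::{real_normed_algebra_1,banach} \<Rightarrow> 'a"
    and adj :: "'a \<Rightarrow> 'a" and n :: nat and s :: "nat \<Rightarrow> 'a" and \<alpha> :: "'a \<Rightarrow> 'a"
  assumes "cstar_algebra cs adj"
    and "2 \<le> n"
    and "cuntz_generators cs adj n s"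
    and "unital_star_endo cs adj \<alpha>"
    and "\<alpha> ` closed_alg_gen cs (s ` {1..n}) \<subseteq> closed_alg_gen cs (s ` {1..n})"
  shows "star_auto cs adj \<alpha> \<and> \<alpha> ` closed_alg_gen cs (s ` {1..n}) = closed_alg_gen cs (s ` {1..n})"
proof -
  interpret cuntz cs adj n s
    using assms(1-3) by unfold_locales
  have image: "\<alpha> ` disk \<subseteq> disk" using assms(5) by (simp add: disk_def)
  show ?thesis
    using image_eq_disk[OF assms(4) image] endo_bij[OF assms(4) image] assms(4)
    unfolding star_auto_def disk_def by blast
qed

end
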